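(* Let $\alpha,\gamma,\rho,a\in\mathbb{C}$ with $a\ne0$, and let $\mu$ be a real number, such that $\operatorname{Re}(\alpha)>0$, $\mu>0$ and $\operatorname{Re}(\rho)>\max\{0,\operatorname{Re}(-\gamma)\}$. Then the left-sided Erdélyi–Kober fractional integral $\mathcal{I}_{\gamma,\alpha}^{+}=\mathcal{I}_{0+}^{\alpha,0,\gamma}$ satisfies, for every $x>0$, $$\left(\mathcal{I}_{\gamma,\alpha}^{+}\left(t^{\rho-1}I^{m,n}_{p,q}\left[at^{\mu}\,\middle|\begin{matrix}(a_i,A_i,\alpha_i)_{1,p}\\(b_j,B_j,\beta_j)_{1,q}\end{matrix}\right]\right)\right)(x)=x^{\rho-1}\,I^{m,n+1}_{p+1,q+1}\left[ax^{\mu}\,\middle|\begin{matrix}(1-\gamma-\rho,\mu,1),\ (a_i,A_i,\alpha_i)_{1,p}\\(b_j,B_j,\beta_j)_{1,q},\ (1-\alpha-\gamma-\rho,\mu,1)\end{matrix}\right].$$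
   Context: **$I$-function.** Let $m,n,p,q$ be integers with $0\le m\le q$, $0\le n\le p$; let $a_i\in\mathbb{C}$, $A_i,\alpha_i>0$ $(1\le i\le p)$ and $b_j\in\mathbb{C}$, $B_j,\beta_j>0$ $(1\le j\le q)$. For $z\neq0$ (with a chosen value of $\arg z$; $z^{-s}=e^{-s(\log|z|+i\arg z)}$), $$I^{m,n}_{p,q}\left[z\,\middle|\begin{matrix}(a_i,A_i,\alpha_i)_{1,p}\\(b_j,B_j,\beta_j)_{1,q}\end{matrix}\right]=\frac{1}{2\pi i}\int_{C}\chi(s)z^{-s}\,ds,\qquad \chi(s)=\frac{\prod_{j=1}^{m}\Gamma^{\beta_j}(b_j+B_js)\prod_{i=1}^{n}\Gamma^{\alpha_i}(1-a_i-A_is)}{\prod_{j=m+1}^{q}\Gamma^{\beta_j}(1-b_j-B_js)\prod_{i=n+1}^{p}\Gamma^{\alpha_i}(a_i+A_is)}.$$ Here $(a_i,A_i,\alpha_i)_{1,p}$ is the ordered list of triples for $i=1,\dots,p$ (the first $n$ upper triples and the first $m$ lower triples enter the numerator), $\Gamma^{\kappa}(w)=(\Gamma(w))^{\kappa}$, with the branch of non-integer powers fixed along $C$ and the same for the same triple in all $I$-functions considered; empty products equal $1$. The singularities of $\Gamma^{\beta_j}(b_j+B_js)$, $j\le m$, lie to the left of $C$ and those of $\Gamma^{\alpha_i}(1-a_i-A_is)$, $i\le n$, to the right. **Standing assumptions.** The contour $C$ is the imaginary axis $\operatorname{Re}(s)=0$, traversed upwards, and for each $I$-function occurring the following conditions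 for absolute convergence hold: with (computed from the parameters of that $I$-function) $\mu^*=\sum_{j=1}^q\beta_jB_j-\sum_{i=1}^p\alpha_iA_i$, $\Omega=\sum_{i=1}^p(\frac12-\operatorname{Re}(a_i))\alpha_i-\sum_{j=1}^q(\frac12-\operatorname{Re}(b_j))\beta_j$, $\Delta=\sum_{j=1}^m\beta_jB_j-\sum_{j=m+1}^q\beta_jB_j+\sum_{i=1}^n\alpha_iA_i-\sum_{i=n+1}^p\alpha_iA_i$, either $\Delta>0$ and $|\arg z|<\frac{\pi}{2}\Delta$, or $\Delta\ge0$, $|\arg z|=\frac{\pi}{2}\Delta$ and one of: $\mu^*=0$ and $\Omega<-1$; or $\mu^*\ne0$ and $\Omega+\sigma\mu^*<-1$ where $\sigma=\operatorname{Re}(s)$ on $C$ (so $\sigma=0$). For $t>0$, $\arg(at^{\pm\mu})=\arg a$. **Operator.** For $\operatorname{Re}(\alpha)>0$, $x>0$, the left-sided Saigo fractional integral is $$\left(\mathcal{I}_{0+}^{\alpha,\beta,\gamma}f\right)(x)=\frac{x^{-\alpha-\beta}}{\Gamma(\alpha)}\int_0^x(x-t)^{\alpha-1}{}_{2}F_1\left(\alpha+\beta,-\gamma;\alpha;1-\tfrac{t}{x}\right)f(t)\,dt,$$ and $\mathcal{I}_{\gamma,\alpha}^{+}:=\mathcal{I}_{0+}^{\alpha,0,\gamma}$. *)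

theory Defs
  imports "HOL-Analysis.Analysis"
begin

text \<open>
  An entry \<open>(c, C, \<kappa>)\<close> of the upper or lower parameter list.  The same type also
  keys the Gamma factor \<open>\<Gamma>(c + C s)\<^sup>\<kappa>\<close> of the integrand; there \<open>C\<close> may be negative.
\<close>
type_synonym triple = "complex \<times> real \<times> real"

abbreviation contour :: "complex set" where
  "contour \<equiv> {s. Re s = 0}"

abbreviation gamma_arg :: "triple \<Rightarrow> complex \<Rightarrow> complex" where
  "gamma_arg \<equiv> \<lambda>(c, C, \<kappa>) s. c + of_real C * s"

text \<open>
  A choice, for every factor \<open>\<Gamma>(c + C s)\<^sup>\<kappa>\<close>, of a branch along the contour: a continuous
  logarithm of \<open>\<Gamma>(c + C s)\<close> on the part of the contour where it has no pole.  Keying the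
  choice by the triple makes equal triples use equal branches in all I-functions.
\<close>
definition gamma_branch :: "(triple \<Rightarrow> complex \<Rightarrow> complex) \<Rightarrow> bool" where
  "gamma_branch L \<longleftrightarrow>
     (\<forall>T. continuous_on {s \<in> contour. gamma_arg T s \<notin> \<int>\<^sub>\<le>\<^sub>0} (L T) \<and>
          (\<forall>s\<in>contour. gamma_arg T s \<notin> \<int>\<^sub>\<le>\<^sub>0 \<longrightarrow> exp (L T s) = Gamma (gamma_arg T s)))"

text \<open>
  At a pole the value is 0.  As \<open>x / 0 = 0\<close>, a factor in the denominator then contributes 0,
  which is the value of \<open>1 / \<Gamma>\<^sup>\<kappa>\<close> there, \<open>1 / \<Gamma>\<close> being entire and \<open>\<kappa> > 0\<close>.  The factors
  in the numerator have no poles on the contour (\<open>I_separated\<close> below).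
\<close>
definition gamma_pow :: "(triple \<Rightarrow> complex \<Rightarrow> complex) \<Rightarrow> triple \<Rightarrow> complex \<Rightarrow> complex" where
  "gamma_pow L = (\<lambda>(c, C, \<kappa>) s.
     if gamma_arg (c, C, \<kappa>) s \<in> \<int>\<^sub>\<le>\<^sub>0 then 0 else exp (of_real \<kappa> * L (c, C, \<kappa>) s))"

text \<open>
  Throughout, \<open>us\<close> is the upper list \<open>(a\<^sub>i, A\<^sub>i, \<alpha>\<^sub>i)\<close>, \<open>ls\<close> the lower list \<open>(b\<^sub>j, B\<^sub>j, \<beta>\<^sub>j)\<close>,
  so that \<open>p = length us\<close> and \<open>q = length ls\<close>.
\<close>
definition I_chi ::
  "(triple \<Rightarrow> complex \<Rightarrow> complex) \<Rightarrow> nat \<Rightarrow> nat \<Rightarrow> triple list \<Rightarrow> triple list \<Rightarrow> complex \<Rightarrow> complex" where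
  "I_chi L m n us ls s =
     ((\<Prod>(b, B, \<beta>)\<leftarrow>take m ls. gamma_pow L (b, B, \<beta>) s) *
      (\<Prod>(a, A, \<alpha>)\<leftarrow>take n us. gamma_pow L (1 - a, - A, \<alpha>) s)) /
     ((\<Prod>(b, B, \<beta>)\<leftarrow>drop m ls. gamma_pow L (1 - b, - B, \<beta>) s) *
      (\<Prod>(a, A, \<alpha>)\<leftarrow>drop n us. gamma_pow L (a, A, \<alpha>) s))"

text \<open>
  The I-function at \<open>z\<close>, with \<open>\<theta>\<close> the chosen value of the argument of \<open>z\<close>; the contour is
  parametrized by \<open>s = \<i> \<tau>\<close>, \<open>ds = \<i> d\<tau>\<close>.
\<close>
definition I_fun ::
  "(triple \<Rightarrow> complex \<Rightarrow> complex) \<Rightarrow> nat \<Rightarrow> nat \<Rightarrow> triple list \<Rightarrow> triple list \<Rightarrow> real \<Rightarrow> complex \<Rightarrow> complex" where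
  "I_fun L m n us ls \<theta> z =
     1 / (2 * of_real pi * \<i>) *
     (LBINT \<tau>. I_chi L m n us ls (\<i> * of_real \<tau>) *
               exp (- (\<i> * of_real \<tau>) * (of_real (ln (cmod z)) + \<i> * of_real \<theta>)) * \<i>)"

definition I_params :: "nat \<Rightarrow> nat \<Rightarrow> triple list \<Rightarrow> triple list \<Rightarrow> bool" where
  "I_params m n us ls \<longleftrightarrow>
     m \<le> length ls \<and> n \<le> length us \<and>
     (\<forall>(a, A, \<alpha>)\<in>set us. A > 0 \<and> \<alpha> > 0) \<and> (\<forall>(b, B, \<beta>)\<in>set ls. B > 0 \<and> \<beta> > 0)"

definition I_separated :: "nat \<Rightarrow> nat \<Rightarrow> triple list \<Rightarrow> triple list \<Rightarrow> bool" where
  "I_separated m n us ls \<longleftrightarrow>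
     (\<forall>(b, B, \<beta>)\<in>set (take m ls). \<forall>s. b + of_real B * s \<in> \<int>\<^sub>\<le>\<^sub>0 \<longrightarrow> Re s < 0) \<and>
     (\<forall>(a, A, \<alpha>)\<in>set (take n us). \<forall>s. 1 - a - of_real A * s \<in> \<int>\<^sub>\<le>\<^sub>0 \<longrightarrow> Re s > 0)"

definition I_mu :: "triple list \<Rightarrow> triple list \<Rightarrow> real" where
  "I_mu us ls = (\<Sum>(b, B, \<beta>)\<leftarrow>ls. \<beta> * B) - (\<Sum>(a, A, \<alpha>)\<leftarrow>us. \<alpha> * A)"

definition I_Omega :: "triple list \<Rightarrow> triple list \<Rightarrow> real" where
  "I_Omega us ls =
     (\<Sum>(a, A, \<alpha>)\<leftarrow>us. (1 / 2 - Re a) * \<alpha>) - (\<Sum>(b, B, \<beta>)\<leftarrow>ls. (1 / 2 - Re b) * \<beta>)"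

definition I_Delta :: "nat \<Rightarrow> nat \<Rightarrow> triple list \<Rightarrow> triple list \<Rightarrow> real" where
  "I_Delta m n us ls =
     (\<Sum>(b, B, \<beta>)\<leftarrow>take m ls. \<beta> * B) - (\<Sum>(b, B, \<beta>)\<leftarrow>drop m ls. \<beta> * B) +
     (\<Sum>(a, A, \<alpha>)\<leftarrow>take n us. \<alpha> * A) - (\<Sum>(a, A, \<alpha>)\<leftarrow>drop n us. \<alpha> * A)"

text \<open>Here \<open>\<sigma>\<close> is the common real part of the points of the contour.\<close>
definition I_abs_conv :: "nat \<Rightarrow> nat \<Rightarrow> triple list \<Rightarrow> triple list \<Rightarrow> real \<Rightarrow> bool" where
  "I_abs_conv m n us ls \<theta> \<longleftrightarrow>
     (let \<Delta> = I_Delta m n us ls; \<Omega> = I_Omega us ls; \<mu> = I_mu us ls; \<sigma> = 0 in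
        (\<Delta> > 0 \<and> \<bar>\<theta>\<bar> < pi / 2 * \<Delta>) \<or>
        (\<Delta> \<ge> 0 \<and> \<bar>\<theta>\<bar> = pi / 2 * \<Delta> \<and>
          ((\<mu> = 0 \<and> \<Omega> < -1) \<or> (\<mu> \<noteq> 0 \<and> \<Omega> + \<sigma> * \<mu> < -1))))"

text \<open>
  The standing assumptions on one I-function.  They involve \<open>z\<close> only through its argument \<open>\<theta>\<close>.
\<close>
definition I_admissible :: "nat \<Rightarrow> nat \<Rightarrow> triple list \<Rightarrow> triple list \<Rightarrow> real \<Rightarrow> bool" where
  "I_admissible m n us ls \<theta> \<longleftrightarrow>
     I_params m n us ls \<and> I_separated m n us ls \<and> I_abs_conv m n us ls \<theta>"

text \<open>The Gauss series, with radius of convergence at least 1.\<close>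
definition hyp2F1 :: "complex \<Rightarrow> complex \<Rightarrow> complex \<Rightarrow> complex \<Rightarrow> complex" where
  "hyp2F1 a b c z = eval_fps (fps_hypergeo [a, b] [c] 1) z"

definition saigo_integrand ::
  "complex \<Rightarrow> complex \<Rightarrow> complex \<Rightarrow> (real \<Rightarrow> complex) \<Rightarrow> real \<Rightarrow> real \<Rightarrow> complex" where
  "saigo_integrand \<alpha> \<beta> \<gamma> f x t =
     of_real (x - t) powr (\<alpha> - 1) * hyp2F1 (\<alpha> + \<beta>) (- \<gamma>) \<alpha> (of_real (1 - t / x)) * f t"

definition saigo_integral ::
  "complex \<Rightarrow> complex \<Rightarrow> complex \<Rightarrow> (real \<Rightarrow> complex) \<Rightarrow> real \<Rightarrow> complex" where
  "saigo_integral \<alpha> \<beta> \<gamma> f x =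
     of_real x powr (- \<alpha> - \<beta>) / Gamma \<alpha> * (LBINT t:{0<..<x}. saigo_integrand \<alpha> \<beta> \<gamma> f x t)"

definition erdelyi_kober ::
  "complex \<Rightarrow> complex \<Rightarrow> (real \<Rightarrow> complex) \<Rightarrow> real \<Rightarrow> complex" where
  "erdelyi_kober \<gamma> \<alpha> f x = saigo_integral \<alpha> 0 \<gamma> f x"

end

theory Submission
  imports Defs "HOL-Real_Asymp.Real_Asymp"
begin

text \<open>
  The integral operator has the kernel \<open>\<^sub>2F\<^sub>1(\<alpha>, -\<gamma>; \<alpha>; 1 - t/x)\<close>.  The parameter \<open>\<alpha>\<close> cancels
  and leaves the binomial series \<open>(t/x)\<^sup>\<gamma>\<close> (\<open>hyp2F1_cancel\<close>).  With the I-function written as its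
  integral over \<open>s = \<i> \<tau>\<close>, the variable \<open>t\<close> occurs only in the factor
  \<open>t\<^sup>c\<^sup>-\<^sup>1 (x - t)\<^sup>\<alpha>\<^sup>-\<^sup>1 t\<^sup>-\<^sup>\<mu>\<^sup>s\<close> where \<open>c = \<gamma> + \<rho>\<close>.  Exchanging the integrals turns this factor into
  the Beta integral \<open>x\<^sup>c\<^sup>+\<^sup>\<alpha>\<^sup>-\<^sup>1\<^sup>-\<^sup>\<mu>\<^sup>s B(c - \<mu> s, \<alpha>)\<close>, and \<open>B(c - \<mu> s, \<alpha>) / \<Gamma>(\<alpha>)\<close> is the
  quotient \<open>\<Gamma>(c - \<mu> s) / \<Gamma>(c + \<alpha> - \<mu> s)\<close>, which is what the two new triples contribute to the
  integrand of the larger I-function (\<open>I_chi_adjoin_quotient\<close>).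

  Two points need analysis.  The exchange of integrals (\<open>Beta_kernel_Fubini\<close>) requires that
  the integrand of the given I-function is absolutely integrable along the imaginary axis.
  Since \<open>\<bar>t\<^sup>-\<^sup>\<mu>\<^sup>s\<bar> = 1\<close> there, the double integral is then dominated by a product of two convergent
  single integrals.  Absolute integrability amounts to the order of magnitude
  \<open>\<bar>\<Gamma>(\<sigma> + \<i> t)\<bar> \<asymp> \<bar>t\<bar>\<^sup>\<sigma>\<^sup>-\<^sup>1\<^sup>/\<^sup>2 exp (- \<pi> \<bar>t\<bar> / 2)\<close> (\<open>norm_Gamma_bigtheta\<close>).  Multiplied over all
  factors it shows that the integrand, the exponential factor in \<open>arg z = \<theta>\<close> included, is
  \<open>O(\<bar>\<tau>\<bar>\<^sup>\<Omega> exp (- (\<pi> \<Delta> / 2 - \<bar>\<theta>\<bar>) \<bar>\<tau>\<bar>))\<close>, and the conditions for absolute convergence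
  say precisely that this majorant is integrable at infinity.

  The order of magnitude of \<open>\<Gamma>\<close> is derived without Stirling's formula.  On the line \<open>Re z = 1/2\<close>
  the reflection formula gives \<open>\<bar>\<Gamma>(z)\<bar>\<^sup>2 = \<pi> / cosh (\<pi> t)\<close> exactly.  For \<open>1/2 \<le> Re z \<le> 3/2\<close> one
  interpolates: as \<open>\<psi>'\<close> is bounded in the half-plane \<open>Re z \<ge> 1/2\<close>, \<open>log \<Gamma>\<close> is on horizontal unit
  segments an affine function up to a bounded error, and its increment over the whole segment is
  \<open>log z\<close>.  The functional equation carries the result to every vertical line.
\<close>

section \<open>The Gamma function on vertical lines\<close>

lemma norm_trigamma_le:
  fixes z :: complex
  assumes "Re z \<ge> 1/2"
  shows "norm (Polygamma 1 z) \<le> Polygamma 1 (1/2 :: real)"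
proof -
  have summ: "summable (\<lambda>k. inverse ((1/2 + real k)\<^sup>2))"
    by (rule Polygamma_converges') auto
  have le: "norm (inverse ((z + of_nat k)\<^sup>2)) \<le> inverse ((1/2 + real k)\<^sup>2)" for k
  proof -
    have "1/2 + real k \<le> \<bar>Re (z + of_nat k)\<bar>" using assms by simp
    also have "\<dots> \<le> norm (z + of_nat k)" by (rule abs_Re_le_cmod)
    finally show ?thesis
      by (simp add: norm_inverse norm_power le_imp_inverse_le power_mono)
  qed
  have "norm (\<Sum>k. inverse ((z + of_nat k)\<^sup>2)) \<le> (\<Sum>k. inverse ((1/2 + real k)\<^sup>2))"
    by (rule norm_suminf_le[OF le summ])
  thus ?thesis by (simp add: Polygamma_def power2_eq_square)
qed

lemma Re_pos_not_nonpos_Ints: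
  assumes "Re z > 0"
  shows "z \<notin> \<int>\<^sub>\<le>\<^sub>0"
  using assms by (auto elim!: nonpos_Ints_cases)


text \<open>
  With \<open>K\<close> a bound of \<open>\<psi>'\<close>, the function \<open>\<psi>\<close> varies by at most \<open>K\<close> along the segment from \<open>z\<close> to
  \<open>z + 1\<close>, so \<open>log \<Gamma>\<close> stays within \<open>K\<close> of its tangent at \<open>z\<close>.  At the end point this reads
  \<open>\<bar>ln \<bar>z\<bar> - Re \<psi>(z)\<bar> \<le> K\<close> because of \<open>\<Gamma>(z + 1) = z \<Gamma>(z)\<close>, which allows the unknown slope \<open>Re \<psi>(z)\<close>
  to be replaced by \<open>ln \<bar>z\<bar>\<close> at the cost of another \<open>K\<close>.
\<close>
lemma ln_norm_Gamma_interpolation: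
  fixes z :: complex
  assumes z: "Re z = 1/2" and d: "0 \<le> d" "d \<le> 1"
  shows "\<bar>ln (norm (Gamma (z + of_real d))) - ln (norm (Gamma z)) - d * ln (norm z)\<bar>
           \<le> 2 * Polygamma 1 (1/2 :: real)"
proof -
  define K :: real where "K = Polygamma 1 (1/2)"
  define S where "S = closed_segment z (z + 1)"
  have S_iff: "w \<in> S \<longleftrightarrow> (\<exists>u. 0 \<le> u \<and> u \<le> 1 \<and> w = z + of_real u)" for w
    unfolding S_def closed_segment_def by (auto simp: scaleR_conv_of_real algebra_simps)
  have Re_S: "Re w \<ge> 1/2" if "w \<in> S" for w
    using that z by (auto simp: S_iff)
  have dist_S: "norm (w - z) \<le> 1" if "w \<in> S" for w
    using that by (auto simp: S_iff)
  have zS: "z \<in> S" by (auto simp: S_iff intro: exI[of _ 0])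
  have K0: "K \<ge> 0" using norm_trigamma_le[of z] z unfolding K_def by (smt (verit) norm_ge_zero)
  have Digamma_lip: "norm (Digamma w - Digamma z) \<le> K" if "w \<in> S" for w
  proof -
    have "norm (Digamma w - Digamma z) \<le> K * norm (w - z)"
    proof (rule field_differentiable_bound[of S _ "Polygamma 1"])
      show "(Digamma has_field_derivative Polygamma 1 u) (at u within S)" if "u \<in> S" for u
        using has_field_derivative_Polygamma[of u 0 S] Re_S[OF that] Re_pos_not_nonpos_Ints[of u] by simp
    qed (use that zS norm_trigamma_le Re_S in \<open>auto simp: K_def S_def\<close>)
    also have "\<dots> \<le> K * 1" using K0 dist_S[OF that] by (rule mult_left_mono[rotated])
    finally show ?thesis by simp
  qed
  \<comment> \<open>The mean value estimate for \<open>log \<Gamma>(w) - w \<psi>(z)\<close>, whose derivative is \<open>\<psi>(w) - \<psi>(z)\<close>.\<close>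
  have lin: "norm (ln_Gamma w - ln_Gamma z - (w - z) * Digamma z) \<le> K" if "w \<in> S" for w
  proof -
    define G where "G = (\<lambda>w. ln_Gamma w - w * Digamma z)"
    have "norm (G w - G z) \<le> K * norm (w - z)"
    proof (rule field_differentiable_bound[of S _ "\<lambda>u. Digamma u - Digamma z"])
      show "(G has_field_derivative (Digamma u - Digamma z)) (at u within S)" if "u \<in> S" for u
      proof -
        have "u \<notin> \<real>\<^sub>\<le>\<^sub>0" using Re_S[OF that] by (auto elim!: nonpos_Reals_cases)
        thus ?thesis unfolding G_def
          by (auto intro!: DERIV_diff DERIV_cmult_right DERIV_ident has_field_derivative_ln_Gamma_complex
              intro: has_field_derivative_at_within
              simp: DERIV_cmult_Id mult.commute[of _ "Digamma z"])
      qed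
    qed (use that zS Digamma_lip in \<open>auto simp: S_def\<close>)
    also have "\<dots> \<le> K * 1" using K0 dist_S[OF that] by (rule mult_left_mono[rotated])
    finally show ?thesis by (simp add: G_def algebra_simps)
  qed
  have ln_norm: "ln (norm (Gamma w)) = Re (ln_Gamma w)" if "Re w > 0" for w :: complex
  proof -
    have "Gamma w = exp (ln_Gamma w)"
      using Re_pos_not_nonpos_Ints[OF that] by (simp add: Gamma_complex_altdef)
    thus ?thesis by simp
  qed
  have R: "\<bar>ln (norm (Gamma (z + of_real u))) - ln (norm (Gamma z)) - u * Re (Digamma z)\<bar> \<le> K"
    if "0 \<le> u" "u \<le> 1" for u
  proof -
    have "\<bar>Re (ln_Gamma (z + of_real u) - ln_Gamma z - (z + of_real u - z) * Digamma z)\<bar> \<le> K"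
      using that by (intro order_trans[OF abs_Re_le_cmod lin]) (auto simp: S_iff)
    thus ?thesis using z that by (simp add: ln_norm)
  qed
  have "z \<noteq> 0" "z \<notin> \<int>\<^sub>\<le>\<^sub>0" using z Re_pos_not_nonpos_Ints[of z] by auto
  hence "ln (norm (Gamma (z + 1))) = ln (norm z) + ln (norm (Gamma z))"
    by (simp add: Gamma_plus1 norm_mult ln_mult Gamma_eq_zero_iff)
  with R[of 1] have one: "\<bar>ln (norm z) - Re (Digamma z)\<bar> \<le> K" by simp
  have "\<bar>d * (ln (norm z) - Re (Digamma z))\<bar> \<le> 1 * K"
    unfolding abs_mult using d one by (intro mult_mono) auto
  with R[OF d] show ?thesis unfolding K_def by (simp add: algebra_simps)
qed

text \<open>For \<open>Re z = 1/2\<close> the point \<open>1 - z\<close> of the reflection formula is the conjugate of \<open>z\<close>.\<close>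
lemma norm_Gamma_half:
  "norm (Gamma (Complex (1/2) t)) ^ 2 = pi / cosh (pi * t)"
proof -
  define z where "z = Complex (1/2) t"
  have 1: "1 - z = cnj z" by (simp add: z_def complex_eq_iff)
  have "sin (of_real pi * z) = cos (\<i> * of_real (pi * t))"
    by (simp add: z_def Complex_eq distrib_left sin_add algebra_simps flip: sin_of_real cos_of_real)
  also have "\<dots> = of_real (cosh (pi * t))"
    by (simp only: cosh_real [symmetric]) (simp add: cosh_field_def exp_minus)
  finally have "Gamma z * cnj (Gamma z) = of_real (pi / cosh (pi * t))"
    using Gamma_reflection_complex[of z] by (simp add: 1 cnj_Gamma)
  hence "complex_of_real (norm (Gamma z) ^ 2) = of_real (pi / cosh (pi * t))"
    by (simp only: complex_norm_square)
  thus ?thesis unfolding of_real_eq_iff z_def .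
qed

text \<open>
  The scale of comparison.  The unit \<open>\<pi> / 2\<close> of the decay rate is the one of a single Gamma factor;
  it makes \<open>d\<close> additive in the coefficients and equal to \<open>\<Delta>\<close> for the integrand of an I-function.
\<close>
definition power_exp :: "real \<Rightarrow> real \<Rightarrow> real \<Rightarrow> real" where
  "power_exp e d t = \<bar>t\<bar> powr e * exp (- (pi / 2 * d * \<bar>t\<bar>))"

lemma power_exp_mult: "power_exp e d t * power_exp e' d' t = power_exp (e + e') (d + d') t"
proof -
  have "exp (- (pi / 2 * (d + d') * \<bar>t\<bar>)) = exp (- (pi / 2 * d * \<bar>t\<bar>)) * exp (- (pi / 2 * d' * \<bar>t\<bar>))"
    by (subst exp_add [symmetric]) (simp add: algebra_simps add_divide_distrib)
  thus ?thesis by (simp add: power_exp_def powr_add)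
qed

lemma power_exp_inverse: "inverse (power_exp e d t) = power_exp (- e) (- d) t"
  by (simp add: power_exp_def powr_minus exp_minus)

lemma power_exp_powr: "power_exp e d t powr k = power_exp (k * e) (k * d) t"
  by (simp add: power_exp_def powr_mult powr_powr exp_powr_real mult_ac)

lemma power_exp_nonneg [simp]: "power_exp e d t \<ge> 0"
  by (simp add: power_exp_def)

lemma norm_Gamma_half_bigtheta:
  "(\<lambda>t. norm (Gamma (Complex (1/2) t))) \<in> \<Theta>[at_infinity](power_exp 0 1)"
proof (rule bigthetaI'[of 1 "sqrt (2 * pi)"])
  show "\<forall>\<^sub>F t in at_infinity. 1 * norm (power_exp 0 1 t) \<le> norm (norm (Gamma (Complex (1/2) t))) \<and>
          norm (norm (Gamma (Complex (1/2) t))) \<le> sqrt (2 * pi) * norm (power_exp 0 1 t)"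
    using eventually_not_equal_at_infinity[of 0]
  proof eventually_elim
    case (elim t)
    have E: "power_exp 0 1 t ^ 2 = exp (- (pi * \<bar>t\<bar>))"
      using elim by (simp add: power_exp_def flip: exp_double)
    have c: "cosh (pi * t) = (exp (pi * \<bar>t\<bar>) + exp (- (pi * \<bar>t\<bar>))) / 2"
      by (cases "t \<ge> 0") (auto simp: cosh_def)
    have "exp (- (pi * \<bar>t\<bar>)) \<le> exp (pi * \<bar>t\<bar>)" by simp
    hence c1: "cosh (pi * t) \<le> exp (pi * \<bar>t\<bar>)" and c2: "exp (pi * \<bar>t\<bar>) / 2 \<le> cosh (pi * t)"
      unfolding c by (auto simp: field_simps)
    have "exp (- (pi * \<bar>t\<bar>)) \<le> pi / cosh (pi * t)"
    proof -
      have "exp (- (pi * \<bar>t\<bar>)) \<le> 1 / cosh (pi * t)"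
        using c1 by (simp add: exp_minus field_simps)
      also have "\<dots> \<le> pi / cosh (pi * t)" using pi_ge_two by (intro divide_right_mono) auto
      finally show ?thesis .
    qed
    hence l: "power_exp 0 1 t \<le> norm (Gamma (Complex (1/2) t))"
      by - (rule power2_le_imp_le, simp_all add: E norm_Gamma_half)
    have "pi / cosh (pi * t) \<le> 2 * pi * exp (- (pi * \<bar>t\<bar>))"
      using c2 by (simp add: exp_minus field_simps)
    hence u: "norm (Gamma (Complex (1/2) t)) \<le> sqrt (2 * pi) * power_exp 0 1 t"
      by - (rule power2_le_imp_le, simp_all add: E norm_Gamma_half power_mult_distrib)
    show ?case using l u by simp
  qed
qed auto

lemma norm_Complex_bigtheta: "(\<lambda>t. norm (Complex s t)) \<in> \<Theta>[at_infinity](power_exp 1 0)"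
proof (rule bigthetaI'[of 1 2])
  have "\<forall>\<^sub>F t in at_infinity. norm (t :: real) \<ge> \<bar>s\<bar>"
    unfolding eventually_at_infinity by (auto intro: exI[of _ "\<bar>s\<bar>"])
  thus "\<forall>\<^sub>F t in at_infinity. 1 * norm (power_exp 1 0 t) \<le> norm (norm (Complex s t)) \<and>
          norm (norm (Complex s t)) \<le> 2 * norm (power_exp 1 0 t)"
  proof eventually_elim
    case (elim t)
    have "\<bar>t\<bar> \<le> norm (Complex s t)" using abs_Im_le_cmod[of "Complex s t"] by simp
    moreover have "norm (Complex s t) \<le> \<bar>s\<bar> + \<bar>t\<bar>" using cmod_le[of "Complex s t"] by simp
    ultimately show ?case using elim by (simp add: power_exp_def)
  qed
qed auto

lemma norm_Gamma_strip_bigtheta: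
  assumes "0 \<le> d" "d \<le> 1"
  shows "(\<lambda>t. norm (Gamma (Complex (1/2 + d) t))) \<in> \<Theta>[at_infinity](power_exp d 1)"
proof -
  define K :: real where "K = 2 * Polygamma 1 (1/2)"
  define g where "g = (\<lambda>t. norm (Gamma (Complex (1/2) t)) * norm (Complex (1/2) t) powr d)"
  have *: "exp (- K) * g t \<le> norm (Gamma (Complex (1/2 + d) t)) \<and>
             norm (Gamma (Complex (1/2 + d) t)) \<le> exp K * g t" for t
  proof -
    define z where "z = Complex (1/2) t"
    have zd: "Complex (1/2 + d) t = z + of_real d" by (simp add: z_def complex_eq_iff)
    have "z \<noteq> 0" "z \<notin> \<int>\<^sub>\<le>\<^sub>0" "z + of_real d \<notin> \<int>\<^sub>\<le>\<^sub>0"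
      using assms by (auto simp: z_def complex_eq_iff intro!: Re_pos_not_nonpos_Ints)
    hence nz: "norm z > 0" "norm (Gamma z) > 0" "norm (Gamma (z + of_real d)) > 0"
      by (simp_all only: zero_less_norm_iff Gamma_eq_zero_iff not_False_eq_True)
    have "\<bar>ln (norm (Gamma (z + of_real d))) - ln (norm (Gamma z)) - d * ln (norm z)\<bar> \<le> K"
      unfolding K_def using assms by (intro ln_norm_Gamma_interpolation) (auto simp: z_def)
    hence "- K + (ln (norm (Gamma z)) + d * ln (norm z)) \<le> ln (norm (Gamma (z + of_real d)))"
          "ln (norm (Gamma (z + of_real d))) \<le> K + (ln (norm (Gamma z)) + d * ln (norm z))"
      by linarith+
    hence "exp (- K + (ln (norm (Gamma z)) + d * ln (norm z))) \<le> norm (Gamma (z + of_real d))"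
          "norm (Gamma (z + of_real d)) \<le> exp (K + (ln (norm (Gamma z)) + d * ln (norm z)))"
      by (metis exp_le_cancel_iff exp_ln nz(3))+
    moreover have "exp (ln (norm (Gamma z)) + d * ln (norm z)) = g t"
      using nz by (auto simp: g_def exp_add powr_def z_def[symmetric])
    ultimately show ?thesis unfolding zd exp_add by simp
  qed
  have "(\<lambda>t. norm (Gamma (Complex (1/2 + d) t))) \<in> \<Theta>[at_infinity](g)"
    using * by (intro bigthetaI'[of "exp (-K)" "exp K"] always_eventually) (auto simp: g_def)
  also have "g \<in> \<Theta>[at_infinity](\<lambda>t. power_exp 0 1 t * power_exp 1 0 t powr d)"
    unfolding g_def using bigtheta_powr[OF norm_Complex_bigtheta[of "1/2"], of d]
    by (intro landau_theta.mult norm_Gamma_half_bigtheta) simp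
  also have "(\<lambda>t. power_exp 0 1 t * power_exp 1 0 t powr d) = power_exp d 1"
    by (simp add: power_exp_powr power_exp_mult)
  finally show ?thesis .
qed

text \<open>
  By the functional equation and \<open>\<bar>s + \<i> t\<bar> \<asymp> \<bar>t\<bar>\<close>.  The equivalence lets the estimate pass from the
  strip \<open>1/2 \<le> Re z \<le> 3/2\<close> to the left as well as to the right.
\<close>
lemma norm_Gamma_shift_bigtheta:
  "(\<lambda>t. norm (Gamma (Complex (s + 1) t))) \<in> \<Theta>[at_infinity](power_exp (e + 1) 1) \<longleftrightarrow>
   (\<lambda>t. norm (Gamma (Complex s t))) \<in> \<Theta>[at_infinity](power_exp e 1)"
proof -
  define G where "G = (\<lambda>s t. norm (Gamma (Complex s t)))"
  have ev: "\<forall>\<^sub>F t in at_infinity. G (s + 1) t = norm (Complex s t) * G s t"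
    using eventually_not_equal_at_infinity[of 0]
  proof eventually_elim
    case (elim t)
    have eq: "Complex (s + 1) t = Complex s t + 1" by (simp add: complex_eq_iff)
    have "Complex s t \<notin> \<int>\<^sub>\<le>\<^sub>0" using elim by (auto elim!: nonpos_Ints_cases simp: complex_eq_iff)
    thus ?case by (simp add: G_def eq Gamma_plus1 norm_mult)
  qed
  have nz: "\<forall>\<^sub>F t in at_infinity. norm (Complex s t) \<noteq> 0"
    using eventually_not_equal_at_infinity[of 0] by eventually_elim (auto simp: complex_eq_iff)
  have pe: "power_exp (e + 1) 1 = (\<lambda>t. power_exp 1 0 t * power_exp e 1 t)"
    by (simp add: power_exp_mult add_ac)
  have "\<Theta>[at_infinity](power_exp (e + 1) 1) =
             \<Theta>[at_infinity](\<lambda>t. norm (Complex s t) * power_exp e 1 t)"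
    unfolding pe by (intro landau_theta.cong_bigtheta landau_theta.mult bigtheta_refl)
       (subst bigtheta_sym, rule norm_Complex_bigtheta)
  hence "G (s + 1) \<in> \<Theta>[at_infinity](power_exp (e + 1) 1) \<longleftrightarrow>
      (\<lambda>t. norm (Complex s t) * G s t) \<in> \<Theta>[at_infinity](\<lambda>t. norm (Complex s t) * power_exp e 1 t)"
    using landau_theta.in_cong[OF ev] by simp
  also have "\<dots> \<longleftrightarrow> G s \<in> \<Theta>[at_infinity](power_exp e 1)"
    by (rule landau_theta.mult_cancel_left[OF bigtheta_refl nz])
  finally show ?thesis unfolding G_def .
qed

lemma norm_Gamma_bigtheta:
  "(\<lambda>t. norm (Gamma (Complex s t))) \<in> \<Theta>[at_infinity](power_exp (s - 1/2) 1)"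
proof -
  have ints: "(\<lambda>t. norm (Gamma (Complex (1/2 + d + of_int k) t))) \<in>
          \<Theta>[at_infinity](power_exp (d + of_int k) 1)" if "0 \<le> d" "d \<le> 1" for d k
  proof (induction k rule: int_induct[where k = 0])
    case base
    show ?case using norm_Gamma_strip_bigtheta[OF that] by simp
  next
    case (step1 k)
    thus ?case using norm_Gamma_shift_bigtheta[of "1/2 + d + of_int k" "d + of_int k"]
      by (simp add: add_ac)
  next
    case (step2 k)
    thus ?case using norm_Gamma_shift_bigtheta[of "1/2 + d + of_int (k - 1)" "d + of_int (k - 1)"]
      by (simp add: add_ac)
  qed
  have "s = 1/2 + frac (s - 1/2) + of_int \<lfloor>s - 1/2\<rfloor>" by (simp add: frac_def)
  moreover have "frac (s - 1/2) + of_int \<lfloor>s - 1/2\<rfloor> = s - 1/2" by (simp add: frac_def)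
  ultimately show ?thesis
    using ints[of "frac (s - 1/2)" "\<lfloor>s - 1/2\<rfloor>"] frac_ge_0[of "s - 1/2"] frac_lt_1[of "s - 1/2"]
    by (simp add: add.assoc)
qed

text \<open>
  Along \<open>s = \<i> t\<close> the argument \<open>c + C s\<close> runs through the line \<open>Re z = Re c\<close> at height \<open>Im c + C t\<close>.
  The shift by \<open>Im c\<close> changes both the power and the exponential by bounded factors only.
\<close>
lemma norm_Gamma_affine_bigtheta:
  assumes "C \<noteq> 0"
  shows "(\<lambda>t. norm (Gamma (c + of_real C * (\<i> * of_real t)))) \<in>
           \<Theta>[at_infinity](power_exp (Re c - 1/2) \<bar>C\<bar>)"
proof -
  define y where "y = Im c"
  have arg: "c + of_real C * (\<i> * of_real t) = Complex (Re c) (y + C * t)" for t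
    by (simp add: complex_eq_iff y_def)
  have lim: "filterlim (\<lambda>t::real. y + C * t) at_infinity at_infinity"
    using assms by (intro tendsto_add_filterlim_at_infinity tendsto_const
      tendsto_mult_filterlim_at_infinity filterlim_ident) auto
  have lin: "(\<lambda>t. y + C * t) \<in> \<Theta>[at_infinity](\<lambda>t. t)"
  proof (rule bigthetaI'[of "\<bar>C\<bar> / 2" "2 * \<bar>C\<bar>"])
    have "\<forall>\<^sub>F t in at_infinity. norm (t :: real) \<ge> 2 * \<bar>y\<bar> / \<bar>C\<bar>"
      unfolding eventually_at_infinity by blast
    thus "\<forall>\<^sub>F t in at_infinity. \<bar>C\<bar> / 2 * norm t \<le> norm (y + C * t) \<and>
            norm (y + C * t) \<le> 2 * \<bar>C\<bar> * norm t"
    proof eventually_elim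
      case (elim t)
      have "2 * \<bar>y\<bar> \<le> \<bar>C * t\<bar>" using elim assms by (simp add: field_simps abs_mult)
      moreover have "\<bar>C * t\<bar> \<le> \<bar>y + C * t\<bar> + \<bar>y\<bar>" "\<bar>y + C * t\<bar> \<le> \<bar>y\<bar> + \<bar>C * t\<bar>" by linarith+
      ultimately show ?case by (simp add: abs_mult)
    qed
  qed (use assms in auto)
  have ex: "(\<lambda>t. exp (- (pi / 2 * \<bar>y + C * t\<bar>))) \<in> \<Theta>[at_infinity](\<lambda>t. exp (- (pi / 2 * \<bar>C\<bar> * \<bar>t\<bar>)))"
  proof (rule bigthetaI'[of "exp (- (pi / 2 * \<bar>y\<bar>))" "exp (pi / 2 * \<bar>y\<bar>)"] ; (intro always_eventually allI)?)
    fix t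
    have "\<bar>y + C * t\<bar> \<le> \<bar>y\<bar> + \<bar>C * t\<bar>" "\<bar>C * t\<bar> \<le> \<bar>y\<bar> + \<bar>y + C * t\<bar>" by linarith+
    hence "pi / 2 * \<bar>y + C * t\<bar> \<le> pi / 2 * (\<bar>y\<bar> + \<bar>C * t\<bar>)"
          "pi / 2 * \<bar>C * t\<bar> \<le> pi / 2 * (\<bar>y\<bar> + \<bar>y + C * t\<bar>)"
      by (intro mult_left_mono; simp)+
    thus "exp (- (pi / 2 * \<bar>y\<bar>)) * norm (exp (- (pi / 2 * \<bar>C\<bar> * \<bar>t\<bar>))) \<le> norm (exp (- (pi / 2 * \<bar>y + C * t\<bar>)))
      \<and> norm (exp (- (pi / 2 * \<bar>y + C * t\<bar>))) \<le> exp (pi / 2 * \<bar>y\<bar>) * norm (exp (- (pi / 2 * \<bar>C\<bar> * \<bar>t\<bar>)))"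
      by (simp add: abs_mult algebra_simps flip: exp_add)
  qed auto
  have "(\<lambda>t. norm (Gamma (c + of_real C * (\<i> * of_real t)))) \<in>
          \<Theta>[at_infinity](\<lambda>t. power_exp (Re c - 1/2) 1 (y + C * t))"
    unfolding arg using landau_theta.compose[OF norm_Gamma_bigtheta[of "Re c"] lim] .
  also have "(\<lambda>t. power_exp (Re c - 1/2) 1 (y + C * t)) \<in>
          \<Theta>[at_infinity](power_exp (Re c - 1/2) \<bar>C\<bar>)"
    unfolding power_exp_def using bigtheta_powr[OF lin] ex by (intro landau_theta.mult) simp_all
  finally show ?thesis .
qed

section \<open>Absolute convergence of the integral defining the I-function\<close>

text \<open>
  The two-sided bound is what allows passing from a factor to its reciprocal.  Continuity is
  stated for the modulus because \<open>\<bar>1 / \<Gamma>\<bar>\<^sup>\<kappa>\<close> is continuous also at its zeros, where the chosen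
  logarithm ends; it provides boundedness on compact sets.
\<close>
definition vertical_growth :: "(real \<Rightarrow> complex) \<Rightarrow> real \<Rightarrow> real \<Rightarrow> bool" where
  "vertical_growth F e d \<longleftrightarrow>
     F \<in> borel_measurable borel \<and> continuous_on UNIV (\<lambda>t. norm (F t)) \<and>
     (\<lambda>t. norm (F t)) \<in> \<Theta>[at_infinity](power_exp e d)"

lemma vertical_growth_1: "vertical_growth (\<lambda>_. 1) 0 0"
proof -
  have "(\<lambda>t. norm (1 :: complex)) \<in> \<Theta>[at_infinity](power_exp 0 0)"
    using eventually_not_equal_at_infinity[of 0]
    by (intro bigthetaI_cong, eventually_elim) (simp add: power_exp_def)
  thus ?thesis by (simp add: vertical_growth_def)
qed

lemma vertical_growth_mult:
  assumes "vertical_growth F e d" "vertical_growth G e' d'"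
  shows "vertical_growth (\<lambda>t. F t * G t) (e + e') (d + d')"
proof -
  have "(\<lambda>t. norm (F t) * norm (G t)) \<in> \<Theta>[at_infinity](\<lambda>t. power_exp e d t * power_exp e' d' t)"
    using assms unfolding vertical_growth_def by (intro landau_theta.mult) auto
  thus ?thesis using assms unfolding vertical_growth_def power_exp_mult norm_mult
    by (auto intro: continuous_intros)
qed

lemma vertical_growth_prod_list:
  assumes "\<And>T. T \<in> set xs \<Longrightarrow> vertical_growth (F T) (e T) (d T)"
  shows "vertical_growth (\<lambda>t. \<Prod>T\<leftarrow>xs. F T t) (\<Sum>T\<leftarrow>xs. e T) (\<Sum>T\<leftarrow>xs. d T)"
  using assms by (induction xs) (auto intro: vertical_growth_1 vertical_growth_mult)

lemma gamma_arg_imaginary_continuous: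
  "continuous_on A (\<lambda>t. c + of_real C * (\<i> * of_real t))"
  by (intro continuous_intros)

lemma gamma_pow_measurable:
  assumes "gamma_branch L"
  shows "(\<lambda>t. gamma_pow L (c, C, \<kappa>) (\<i> * of_real t)) \<in> borel_measurable borel"
proof -
  define N where "N = {t. c + of_real C * (\<i> * of_real t) \<in> \<int>\<^sub>\<le>\<^sub>0}"
  have "closed N"
    using closed_vimage[OF closed_nonpos_Ints gamma_arg_imaginary_continuous[of UNIV c C]]
    by (simp add: N_def vimage_def)
  moreover have "continuous_on {s \<in> contour. gamma_arg (c, C, \<kappa>) s \<notin> \<int>\<^sub>\<le>\<^sub>0} (L (c, C, \<kappa>))"
    using assms unfolding gamma_branch_def by blast
  hence "continuous_on (- N) (\<lambda>t. L (c, C, \<kappa>) (\<i> * of_real t))"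
    by (rule continuous_on_compose2) (auto intro!: continuous_intros simp: N_def)
  ultimately have "(\<lambda>t. if t \<in> N then 0 else exp (of_real \<kappa> * L (c, C, \<kappa>) (\<i> * of_real t)))
      \<in> borel_measurable borel"
    by (intro borel_measurable_continuous_on_if continuous_intros) auto
  thus ?thesis by (simp add: gamma_pow_def N_def)
qed

text \<open>
  This holds at the poles of \<open>\<Gamma>\<close> as well: there \<open>gamma_pow\<close> is 0, its inverse is 0 too, and
  \<open>rGamma\<close> vanishes.  It is independent of the chosen branch because \<open>\<kappa>\<close> is real.
\<close>
lemma norm_inverse_gamma_pow:
  assumes "gamma_branch L" "\<kappa> > 0"
  shows "norm (inverse (gamma_pow L (c, C, \<kappa>) (\<i> * of_real t))) =
           norm (rGamma (c + of_real C * (\<i> * of_real t))) powr \<kappa>"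
proof (cases "c + of_real C * (\<i> * of_real t) \<in> \<int>\<^sub>\<le>\<^sub>0")
  case True
  thus ?thesis using assms by (simp add: gamma_pow_def rGamma_eq_zero_iff)
next
  case False
  define l where "l = L (c, C, \<kappa>) (\<i> * of_real t)"
  have "exp l = Gamma (c + of_real C * (\<i> * of_real t))"
    using assms(1) False unfolding gamma_branch_def l_def
    by (metis (mono_tags, lifting) case_prod_conv imaginary_unit.sel(1) Re_i_times Im_complex_of_real
        mem_Collect_eq minus_zero)
  hence "rGamma (c + of_real C * (\<i> * of_real t)) = exp (- l)"
    by (simp add: rGamma_inverse_Gamma exp_minus)
  thus ?thesis using False by (simp add: gamma_pow_def l_def[symmetric] norm_inverse exp_minus [symmetric] powr_def)
qed

lemma vertical_growth_inverse_gamma_pow: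
  assumes "gamma_branch L" "\<kappa> > 0" "C \<noteq> 0"
  shows "vertical_growth (\<lambda>t. inverse (gamma_pow L (c, C, \<kappa>) (\<i> * of_real t)))
           (\<kappa> * (1/2 - Re c)) (- (\<kappa> * \<bar>C\<bar>))"
proof -
  let ?a = "\<lambda>t. c + of_real C * (\<i> * of_real t)"
  have "continuous_on UNIV (\<lambda>t. norm (rGamma (?a t)) powr \<kappa>)"
    using assms by (intro continuous_on_powr' continuous_on_norm continuous_on_const
        continuous_on_compose2[OF continuous_on_rGamma gamma_arg_imaginary_continuous]) auto
  moreover have "(\<lambda>t. \<bar>inverse (norm (Gamma (?a t)))\<bar> powr \<kappa>) \<in>
      \<Theta>[at_infinity](\<lambda>t. \<bar>inverse (power_exp (Re c - 1/2) \<bar>C\<bar> t)\<bar> powr \<kappa>)"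
    by (intro bigtheta_powr) (simp add: norm_Gamma_affine_bigtheta assms)
  hence "(\<lambda>t. norm (rGamma (?a t)) powr \<kappa>) \<in>
      \<Theta>[at_infinity](power_exp (\<kappa> * (1/2 - Re c)) (- (\<kappa> * \<bar>C\<bar>)))"
    by (simp add: power_exp_inverse power_exp_powr rGamma_inverse_Gamma norm_inverse)
  moreover have "(\<lambda>t. inverse (gamma_pow L (c, C, \<kappa>) (\<i> * of_real t))) \<in> borel_measurable borel"
    using gamma_pow_measurable[OF assms(1)] by (rule borel_measurable_inverse)
  ultimately show ?thesis
    unfolding vertical_growth_def norm_inverse_gamma_pow[OF assms(1,2)] by blast
qed

lemma vertical_growth_gamma_pow:
  assumes "gamma_branch L" "\<kappa> > 0" "C \<noteq> 0"
    and "\<And>t::real. c + of_real C * (\<i> * of_real t) \<notin> \<int>\<^sub>\<le>\<^sub>0"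
  shows "vertical_growth (\<lambda>t. gamma_pow L (c, C, \<kappa>) (\<i> * of_real t)) (\<kappa> * (Re c - 1/2)) (\<kappa> * \<bar>C\<bar>)"
proof -
  let ?g = "\<lambda>t. gamma_pow L (c, C, \<kappa>) (\<i> * of_real t)"
  have inv: "continuous_on UNIV (\<lambda>t. norm (inverse (?g t)))"
    "(\<lambda>t. norm (inverse (?g t))) \<in> \<Theta>[at_infinity](power_exp (\<kappa> * (1/2 - Re c)) (- (\<kappa> * \<bar>C\<bar>)))"
    using vertical_growth_inverse_gamma_pow[OF assms(1-3), of c] unfolding vertical_growth_def by auto
  have nz: "norm (inverse (?g t)) \<noteq> 0" for t
    using assms(4)[of t] unfolding norm_inverse_gamma_pow[OF assms(1,2)] by (simp add: rGamma_eq_zero_iff)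
  have "continuous_on UNIV (\<lambda>t. inverse (norm (inverse (?g t))))"
    using inv(1) nz by (intro continuous_on_inverse) auto
  moreover have "(\<lambda>t. inverse (norm (inverse (?g t)))) \<in>
      \<Theta>[at_infinity](\<lambda>t. inverse (power_exp (\<kappa> * (1/2 - Re c)) (- (\<kappa> * \<bar>C\<bar>)) t))"
    unfolding bigtheta_inverse by (rule inv(2))
  moreover have "\<kappa> * (Re c - 1/2) = - (\<kappa> * (1/2 - Re c))" by (simp add: algebra_simps)
  ultimately show ?thesis
    using gamma_pow_measurable[OF assms(1)]
    unfolding vertical_growth_def by (simp add: power_exp_inverse norm_inverse)
qed

lemma inverse_prod_list: "inverse (prod_list xs) = prod_list (map inverse (xs :: 'a :: field list))"
  by (induction xs) auto

lemma sum_list_take_drop: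
  "(\<Sum>x\<leftarrow>xs. f x) = (\<Sum>x\<leftarrow>take n xs. f x) + (\<Sum>x\<leftarrow>drop n xs. f x :: real)"
  by (metis append_take_drop_id map_append sum_list_append)

text \<open>
  A triple \<open>(c, C, \<kappa>)\<close> contributes \<open>\<plusminus>\<kappa> (Re c - 1/2)\<close> to the exponent of \<open>\<bar>\<tau>\<bar>\<close> and \<open>\<plusminus>\<kappa> \<bar>C\<bar>\<close> to the rate of
  decay, with a minus sign in the denominator.  Replacing \<open>c\<close> by \<open>1 - c\<close> also flips the sign of the
  former.  Hence the exponents add up to \<open>\<Omega>\<close>, which does not depend on \<open>m\<close> and \<open>n\<close>, whereas the
  rates add up to \<open>\<Delta>\<close>, which does.  Separation keeps the poles of the numerator off the contour.
\<close>
lemma vertical_growth_I_chi: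
  assumes L: "gamma_branch L" and par: "I_params m n us ls" and sep: "I_separated m n us ls"
  shows "vertical_growth (\<lambda>t. I_chi L m n us ls (\<i> * of_real t)) (I_Omega us ls) (I_Delta m n us ls)"
proof -
  have us: "A > 0 \<and> \<kappa> > 0" if "(a, A, \<kappa>) \<in> set us" for a A \<kappa>
    using par that unfolding I_params_def by fast
  have ls: "B > 0 \<and> \<kappa> > 0" if "(b, B, \<kappa>) \<in> set ls" for b B \<kappa>
    using par that unfolding I_params_def by fast
  have Re0: "Re (\<i> * of_real t) = 0" for t by simp
  have 1: "vertical_growth (\<lambda>t. \<Prod>(b, B, \<kappa>)\<leftarrow>take m ls. gamma_pow L (b, B, \<kappa>) (\<i> * of_real t))
     (\<Sum>(b, B, \<kappa>)\<leftarrow>take m ls. \<kappa> * (Re b - 1/2)) (\<Sum>(b, B, \<kappa>)\<leftarrow>take m ls. \<kappa> * B)"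
    unfolding split_def
  proof (rule vertical_growth_prod_list)
    fix T assume T: "T \<in> set (take m ls)"
    obtain b B \<kappa> where [simp]: "T = (b, B, \<kappa>)" by (cases T)
    have "B > 0" "\<kappa> > 0" using ls[of b B \<kappa>] T by (auto dest: in_set_takeD)
    moreover have "b + of_real B * (\<i> * of_real t) \<notin> \<int>\<^sub>\<le>\<^sub>0" for t
      using sep T Re0[of t] unfolding I_separated_def by fastforce
    ultimately show "vertical_growth (\<lambda>t. gamma_pow L (fst T, fst (snd T), snd (snd T)) (\<i> * of_real t))
      (snd (snd T) * (Re (fst T) - 1 / 2)) (snd (snd T) * fst (snd T))"
      using vertical_growth_gamma_pow[OF L, of \<kappa> B b] by simp
  qed
  have 2: "vertical_growth (\<lambda>t. \<Prod>(a, A, \<kappa>)\<leftarrow>take n us. gamma_pow L (1 - a, - A, \<kappa>) (\<i> * of_real t))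
     (\<Sum>(a, A, \<kappa>)\<leftarrow>take n us. \<kappa> * (1/2 - Re a)) (\<Sum>(a, A, \<kappa>)\<leftarrow>take n us. \<kappa> * A)"
    unfolding split_def
  proof (rule vertical_growth_prod_list)
    fix T assume T: "T \<in> set (take n us)"
    obtain a A \<kappa> where [simp]: "T = (a, A, \<kappa>)" by (cases T)
    have "A > 0" "\<kappa> > 0" using us[of a A \<kappa>] T by (auto dest: in_set_takeD)
    moreover have "1 - a + of_real (- A) * (\<i> * of_real t) \<notin> \<int>\<^sub>\<le>\<^sub>0" for t
    proof -
      have "1 - a - of_real A * (\<i> * of_real t) \<notin> \<int>\<^sub>\<le>\<^sub>0"
        using sep T Re0[of t] unfolding I_separated_def by fastforce
      thus ?thesis by simp
    qed
    ultimately show "vertical_growth (\<lambda>t. gamma_pow L (1 - fst T, - fst (snd T), snd (snd T)) (\<i> * of_real t))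
      (snd (snd T) * (1 / 2 - Re (fst T))) (snd (snd T) * fst (snd T))"
      using vertical_growth_gamma_pow[OF L, of \<kappa> "- A" "1 - a"] by simp
  qed
  have 3: "vertical_growth (\<lambda>t. \<Prod>(b, B, \<kappa>)\<leftarrow>drop m ls. inverse (gamma_pow L (1 - b, - B, \<kappa>) (\<i> * of_real t)))
     (\<Sum>(b, B, \<kappa>)\<leftarrow>drop m ls. \<kappa> * (Re b - 1/2)) (\<Sum>(b, B, \<kappa>)\<leftarrow>drop m ls. - (\<kappa> * B))"
    unfolding split_def
  proof (rule vertical_growth_prod_list)
    fix T assume T: "T \<in> set (drop m ls)"
    obtain b B \<kappa> where [simp]: "T = (b, B, \<kappa>)" by (cases T)
    have "B > 0" "\<kappa> > 0" using ls[of b B \<kappa>] T by (auto dest: in_set_dropD)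
    thus "vertical_growth (\<lambda>t. inverse (gamma_pow L (1 - fst T, - fst (snd T), snd (snd T)) (\<i> * of_real t)))
      (snd (snd T) * (Re (fst T) - 1 / 2)) (- (snd (snd T) * fst (snd T)))"
      using vertical_growth_inverse_gamma_pow[OF L, of \<kappa> "- B" "1 - b"] by simp
  qed
  have 4: "vertical_growth (\<lambda>t. \<Prod>(a, A, \<kappa>)\<leftarrow>drop n us. inverse (gamma_pow L (a, A, \<kappa>) (\<i> * of_real t)))
     (\<Sum>(a, A, \<kappa>)\<leftarrow>drop n us. \<kappa> * (1/2 - Re a)) (\<Sum>(a, A, \<kappa>)\<leftarrow>drop n us. - (\<kappa> * A))"
    unfolding split_def
  proof (rule vertical_growth_prod_list)
    fix T assume T: "T \<in> set (drop n us)"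
    obtain a A \<kappa> where [simp]: "T = (a, A, \<kappa>)" by (cases T)
    have "A > 0" "\<kappa> > 0" using us[of a A \<kappa>] T by (auto dest: in_set_dropD)
    thus "vertical_growth (\<lambda>t. inverse (gamma_pow L (fst T, fst (snd T), snd (snd T)) (\<i> * of_real t)))
      (snd (snd T) * (1 / 2 - Re (fst T))) (- (snd (snd T) * fst (snd T)))"
      using vertical_growth_inverse_gamma_pow[OF L, of \<kappa> A a] by simp
  qed
  have neg: "(\<Sum>x\<leftarrow>xs. - f x) = - (\<Sum>x\<leftarrow>xs. f x)" for f :: "triple \<Rightarrow> real" and xs
    by (induction xs) auto
  have Omega: "I_Omega us ls =
      (\<Sum>(b, B, \<kappa>)\<leftarrow>take m ls. \<kappa> * (Re b - 1/2)) + (\<Sum>(a, A, \<kappa>)\<leftarrow>take n us. \<kappa> * (1/2 - Re a)) +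
      ((\<Sum>(b, B, \<kappa>)\<leftarrow>drop m ls. \<kappa> * (Re b - 1/2)) + (\<Sum>(a, A, \<kappa>)\<leftarrow>drop n us. \<kappa> * (1/2 - Re a)))"
  proof -
    have flip: "(\<lambda>(b, B, \<kappa>). \<kappa> * (Re b - 1/2)) = (\<lambda>T. - (case T of (b, B, \<kappa>) \<Rightarrow> (1/2 - Re b) * \<kappa>))"
      by (auto simp: fun_eq_iff algebra_simps)
    have comm: "(\<lambda>(b, B, \<kappa>). \<kappa> * (1/2 - Re b)) = (\<lambda>(b, B, \<kappa>). (1/2 - Re b) * \<kappa>)"
      by (auto simp: fun_eq_iff algebra_simps)
    show ?thesis
      unfolding I_Omega_def flip comm neg
      by (subst sum_list_take_drop[of _ us n], subst sum_list_take_drop[of _ ls m]) simp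
  qed
  have Delta: "I_Delta m n us ls =
      (\<Sum>(b, B, \<kappa>)\<leftarrow>take m ls. \<kappa> * B) + (\<Sum>(a, A, \<kappa>)\<leftarrow>take n us. \<kappa> * A) +
      ((\<Sum>(b, B, \<kappa>)\<leftarrow>drop m ls. - (\<kappa> * B)) + (\<Sum>(a, A, \<kappa>)\<leftarrow>drop n us. - (\<kappa> * A)))"
    unfolding I_Delta_def split_def neg by simp
  have chi: "I_chi L m n us ls s =
      (\<Prod>(b, B, \<kappa>)\<leftarrow>take m ls. gamma_pow L (b, B, \<kappa>) s) *
      (\<Prod>(a, A, \<kappa>)\<leftarrow>take n us. gamma_pow L (1 - a, - A, \<kappa>) s) *
      ((\<Prod>(b, B, \<kappa>)\<leftarrow>drop m ls. inverse (gamma_pow L (1 - b, - B, \<kappa>) s)) *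
       (\<Prod>(a, A, \<kappa>)\<leftarrow>drop n us. inverse (gamma_pow L (a, A, \<kappa>) s)))" for s
    unfolding I_chi_def divide_inverse inverse_mult_distrib inverse_prod_list
    by (simp add: o_def split_def)
  show ?thesis
    unfolding Omega Delta chi by (intro vertical_growth_mult 1 2 3 4)
qed

lemma integrable_powr_at_infinity:
  fixes p R :: real
  assumes "p < -1" "R > 0"
  shows "integrable lborel (\<lambda>t. indicator {R..} \<bar>t\<bar> * \<bar>t\<bar> powr p)"
proof -
  define q where "q = (\<lambda>t::real. indicator {R..} t * t powr p)"
  \<comment> \<open>The function is the sum of the right tail and its mirror image.\<close>
  have "(\<lambda>t. t powr p) absolutely_integrable_on {R..}"
    using has_integral_powr_to_inf[OF assms] by (intro nonnegative_absolutely_integrable_1) auto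
  moreover have "q \<in> borel_measurable lborel" unfolding q_def by measurable
  ultimately have q: "integrable lborel q"
    by (simp add: set_integrable_def integrable_completion q_def)
  hence "integrable lborel (\<lambda>t. q t + q (0 + (-1) * t))"
    by (intro Bochner_Integration.integrable_add lborel_integrable_real_affine) auto
  also have "(\<lambda>t. q t + q (0 + (-1) * t)) = (\<lambda>t. indicator {R..} \<bar>t\<bar> * \<bar>t\<bar> powr p)"
    using assms by (auto simp: q_def fun_eq_iff indicator_def)
  finally show ?thesis .
qed

text \<open>
  The two alternatives are those of the absolute convergence conditions: either some exponential
  decay \<open>exp (- \<delta> \<bar>t\<bar>)\<close> remains after the factor \<open>exp (\<bar>\<theta>\<bar> \<bar>t\<bar>)\<close> is taken into account, or it is
  consumed exactly and the power \<open>\<bar>t\<bar>\<^sup>e\<close> has to be integrable by itself.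
\<close>
lemma integrable_vertical_growth:
  assumes F: "vertical_growth F e d"
    and \<theta>: "\<bar>\<theta>\<bar> < pi / 2 * d \<or> \<bar>\<theta>\<bar> = pi / 2 * d \<and> e < -1"
  shows "integrable lborel (\<lambda>t. norm (F t) * exp (\<bar>\<theta>\<bar> * \<bar>t\<bar>))"
proof -
  define g where "g = (\<lambda>t. norm (F t) * exp (\<bar>\<theta>\<bar> * \<bar>t\<bar>))"
  have cont: "continuous_on A g" for A
  proof -
    have "continuous_on A (\<lambda>t. norm (F t))"
      using F unfolding vertical_growth_def by (auto intro: continuous_on_subset)
    thus ?thesis unfolding g_def by (intro continuous_on_mult) (auto intro!: continuous_intros)
  qed
  define \<delta> where "\<delta> = pi / 2 * d - \<bar>\<theta>\<bar>"
  have bigo: "g \<in> O[at_infinity](\<lambda>t. power_exp e d t * exp (\<bar>\<theta>\<bar> * \<bar>t\<bar>))"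
    using F unfolding vertical_growth_def g_def by (intro landau_o.big.mult) auto
  have eq: "power_exp e d t * exp (\<bar>\<theta>\<bar> * \<bar>t\<bar>) = \<bar>t\<bar> powr e * exp (- \<delta> * \<bar>t\<bar>)" for t
    by (simp add: power_exp_def \<delta>_def algebra_simps flip: exp_add)
  obtain p where p: "p < -1" "g \<in> O[at_infinity](\<lambda>t. \<bar>t\<bar> powr p)"
  proof (cases "\<delta> > 0")
    case True
    have "(\<lambda>x::real. x powr e * exp (- \<delta> * x)) \<in> O(\<lambda>x. x powr (-2))"
      using True by real_asymp
    hence "(\<lambda>t. \<bar>t\<bar> powr e * exp (- \<delta> * \<bar>t\<bar>)) \<in> O[at_infinity](\<lambda>t::real. \<bar>t\<bar> powr (-2))"
      by (rule landau_o.big.compose) (use filterlim_norm_at_top[where 'a = real] in \<open>simp add: real_norm_def[abs_def]\<close>)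
    with bigo that[of "-2"] show ?thesis unfolding eq by (auto intro: landau_o.big_trans)
  next
    case False
    with \<theta> have "\<delta> = 0" "e < -1" by (auto simp: \<delta>_def)
    thus ?thesis using bigo that[of e] unfolding eq by simp
  qed
  obtain c where c: "c > 0" "\<forall>\<^sub>F t in at_infinity. norm (g t) \<le> c * norm (\<bar>t\<bar> powr p)"
    using landau_o.bigE[OF p(2)] by blast
  then obtain b where b: "\<And>t. norm t \<ge> b \<Longrightarrow> norm (g t) \<le> c * norm (\<bar>t\<bar> powr p)"
    unfolding eventually_at_infinity by blast
  define R where "R = max 1 b"
  have int: "integrable lborel (\<lambda>t. indicator {-R..R} t *\<^sub>R \<bar>g t\<bar> + c * (indicator {R..} \<bar>t\<bar> * \<bar>t\<bar> powr p))"
    using p by (intro Bochner_Integration.integrable_add integrable_mult_right borel_integrable_compact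
        integrable_powr_at_infinity continuous_intros cont) (auto simp: R_def)
  have "g \<in> borel_measurable lborel"
    using borel_measurable_continuous_onI[OF cont] by simp
  thus ?thesis unfolding g_def[symmetric]
  proof (rule Bochner_Integration.integrable_bound[OF int _ AE_I2])
    fix t
    show "norm (g t) \<le> norm (indicator {-R..R} t *\<^sub>R \<bar>g t\<bar> + c * (indicator {R..} \<bar>t\<bar> * \<bar>t\<bar> powr p))"
    proof (cases "\<bar>t\<bar> \<le> R")
      case True
      hence "t \<in> {-R..R}" by auto
      thus ?thesis using c by simp
    next
      case False
      thus ?thesis using b[of t] c by (auto simp: R_def indicator_def)
    qed
  qed
qed

section \<open>The Beta integral for complex parameters\<close>

lemma norm_of_real_powr: "t > 0 \<Longrightarrow> norm (of_real t powr (z :: complex)) = t powr Re z"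
  by (simp add: norm_powr_real_powr)

text \<open>
  Written out, the principal branch is a case distinction on the sign of the real base, each case
  being composed of measurable functions.
\<close>
lemma borel_measurable_of_real_powr [measurable]:
  assumes [measurable]: "f \<in> borel_measurable M"
  shows "(\<lambda>t. of_real (f t) powr (z :: complex)) \<in> borel_measurable M"
proof -
  have "of_real r powr z =
      (if r = 0 then 0 else exp (z * (of_real (ln \<bar>r\<bar>) + (if r < 0 then \<i> * pi else 0))))" for r :: real
  proof (cases "r < 0")
    case True
    hence "Ln (of_real r) = of_real (ln \<bar>r\<bar>) + \<i> * pi"
      using Ln_of_real' [of r] by auto
    thus ?thesis using True by (simp add: powr_def)
  qed (auto simp: powr_def Ln_of_real)
  thus ?thesis by simp
qed

lemma Beta_set_integrable:
  fixes a b :: complex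
  assumes "Re a > 0" "Re b > 0"
  shows "set_integrable lborel {0<..<1} (\<lambda>u. of_real u powr (a - 1) * of_real (1 - u) powr (b - 1))"
proof -
  have "set_integrable lborel {0<..<1} (\<lambda>u. u powr (Re a - 1) * (1 - u) powr (Re b - 1))"
    by (rule set_integrable_subset[OF integrable_Beta]) (use assms in auto)
  thus ?thesis unfolding set_integrable_def
    by (rule Bochner_Integration.integrable_bound)
       (auto simp: indicator_def norm_mult norm_of_real_powr simp del: of_real_diff)
qed

lemma powr_of_real_mult:
  assumes "x > 0" "u > 0"
  shows "of_real (x * u) powr (z :: complex) = of_real x powr z * of_real u powr z"
  using assms by (simp add: powr_times_real)

text \<open>Substitution \<open>t = x u\<close>.\<close>
lemma Beta_interval:
  fixes a b :: complex
  assumes "Re a > 0" "Re b > 0" "x > 0"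
  defines "k \<equiv> (\<lambda>t. of_real t powr (a - 1) * of_real (x - t) powr (b - 1))"
  shows "set_integrable lborel {0<..<x} k"
    and "(LBINT t:{0<..<x}. k t) = of_real x powr (a + b - 1) *
           (LBINT u:{0<..<1}. of_real u powr (a - 1) * of_real (1 - u) powr (b - 1))"
proof -
  define k1 where "k1 = (\<lambda>u. of_real u powr (a - 1) * of_real (1 - u) powr (b - 1))"
  have scale: "indicator {0<..<x} (0 + x * u) *\<^sub>R k (0 + x * u) =
      of_real x powr (a + b - 2) * (indicator {0<..<1} u *\<^sub>R k1 u)" for u
  proof (cases "u \<in> {0<..<1}")
    case True
    have "k (x * u) = of_real (x * u) powr (a - 1) * of_real (x * (1 - u)) powr (b - 1)"
      by (simp add: k_def algebra_simps)
    also have "\<dots> = of_real x powr (a - 1) * of_real x powr (b - 1) * k1 u"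
      using True assms(3) by (simp only: powr_of_real_mult k1_def mult_ac greaterThanLessThan_iff diff_gt_0_iff_gt)
    also have "of_real x powr (a - 1) * of_real x powr (b - 1) = (of_real x powr (a + b - 2) :: complex)"
      by (simp add: algebra_simps flip: powr_add)
    finally show ?thesis using True assms(3) by (simp add: mult_less_cancel_left1)
  next
    case False
    thus ?thesis using assms(3) by (auto simp: indicator_def zero_less_mult_iff)
  qed
  have "integrable lborel (\<lambda>u. indicator {0<..<x} (0 + x * u) *\<^sub>R k (0 + x * u))"
    unfolding scale using Beta_set_integrable[OF assms(1,2)]
    by (intro integrable_mult_right) (simp add: set_integrable_def k1_def)
  thus "set_integrable lborel {0<..<x} k"
    using assms(3) lborel_integrable_real_affine_iff[of x "\<lambda>t. indicator {0<..<x} t *\<^sub>R k t" 0]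
    by (simp add: set_integrable_def)
  have "(LBINT t:{0<..<x}. k t) = \<bar>x\<bar> *\<^sub>R (LBINT u. indicator {0<..<x} (0 + x * u) *\<^sub>R k (0 + x * u))"
    unfolding set_lebesgue_integral_def using assms(3) by (intro lborel_integral_real_affine) simp
  also have "\<dots> = of_real x * of_real x powr (a + b - 2) * (LBINT u:{0<..<1}. k1 u)"
    unfolding scale set_lebesgue_integral_def using assms(3) by (simp add: scaleR_conv_of_real)
  also have "of_real x * of_real x powr (a + b - 2) = (of_real x powr (a + b - 1) :: complex)"
  proof -
    have "of_real x * of_real x powr (a + b - 2) = of_real x powr 1 * (of_real x powr (a + b - 2) :: complex)"
      using assms(3) by simp
    also have "\<dots> = of_real x powr (1 + (a + b - 2))" by (rule powr_add [symmetric])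
    also have "1 + (a + b - 2) = a + b - 1" by simp
    finally show ?thesis .
  qed
  finally show "(LBINT t:{0<..<x}. k t) = of_real x powr (a + b - 1) * (LBINT u:{0<..<1}. k1 u)" .
qed

text \<open>
  Fubini's theorem together with the translation invariance of the inner integral.  This is the
  bridge from the Gamma integral to the Beta integral.
\<close>
lemma lborel_convolution:
  fixes f g :: "real \<Rightarrow> complex"
  assumes f: "integrable lborel f" and g: "integrable lborel g"
  shows "(LBINT u. LBINT t. f t * g (u - t)) = (LBINT t. f t) * (LBINT u. g u)"
proof -
  note [measurable] = borel_measurable_integrable[OF f] borel_measurable_integrable[OF g]
  have shift_int: "integrable lborel (\<lambda>u. h (u - t))" if "integrable lborel h" for h :: "real \<Rightarrow> complex" and t
    using lborel_integrable_real_affine[OF that, of 1 "-t"] by (simp add: algebra_simps)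
  have shift: "(LBINT u. h (u - t)) = (LBINT u. h u)" for h :: "real \<Rightarrow> complex" and t
    using lborel_integral_real_affine[of 1 h "-t"] by (simp add: algebra_simps)
  have shift': "(LBINT u. norm (g (u - t))) = (LBINT u. norm (g u))" for t
    using lborel_integral_real_affine[of 1 "\<lambda>u. norm (g u)" "-t"] by (simp add: algebra_simps)
  have "integrable (lborel \<Otimes>\<^sub>M lborel) (\<lambda>(t, u). f t * g (u - t))"
  proof (rule lborel_pair.Fubini_integrable)
    show "(\<lambda>(t, u). f t * g (u - t)) \<in> borel_measurable (lborel \<Otimes>\<^sub>M lborel)" by measurable
    show "integrable lborel (\<lambda>t. LBINT u. norm (case (t, u) of (t, u) \<Rightarrow> f t * g (u - t)))"
      using f by (simp add: norm_mult shift')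
    show "AE t in lborel. integrable lborel (\<lambda>u. case (t, u) of (t, u) \<Rightarrow> f t * g (u - t))"
      using shift_int[OF g] by simp
  qed
  from lborel_pair.Fubini_integral[OF this]
  have "(LBINT u. LBINT t. f t * g (u - t)) = (LBINT t. LBINT u. f t * g (u - t))" .
  also have "\<dots> = (LBINT t. f t) * (LBINT u. g u)" by (simp add: shift)
  finally show ?thesis .
qed

lemma Gamma_lebesgue_integral:
  fixes z :: complex
  assumes "Re z > 0"
  defines "f \<equiv> (\<lambda>t. indicator {0<..} t *\<^sub>R (of_real t powr (z - 1) / of_real (exp t)))"
  shows "integrable lborel f" "(LBINT t. f t) = Gamma z"
proof -
  have meas: "f \<in> borel_measurable lborel" unfolding f_def by measurable
  have "(\<lambda>t. of_real t powr (z - 1) / of_real (exp t)) absolutely_integrable_on {0<..}"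
    by (rule absolutely_integrable_Gamma_integral'[OF assms(1)])
  thus int: "integrable lborel f"
    using meas by (simp add: set_integrable_def integrable_completion f_def)
  have "(f has_integral (LBINT t. f t)) UNIV"
    using has_integral_integral_lborel[OF int] .
  moreover have "f = (\<lambda>t. if t \<in> {0<..} then of_real t powr (z - 1) / of_real (exp t) else 0)"
    by (auto simp: f_def)
  hence "(f has_integral Gamma z) UNIV"
    using Gamma_integral_complex'[OF assms(1)] by (simp only: has_integral_restrict_UNIV)
  ultimately show "(LBINT t. f t) = Gamma z" by (rule has_integral_unique)
qed

text \<open>
  The convolution of \<open>t\<^sup>a\<^sup>-\<^sup>1 e\<^sup>-\<^sup>t\<close> and \<open>t\<^sup>b\<^sup>-\<^sup>1 e\<^sup>-\<^sup>t\<close> on the half-line is \<open>u\<^sup>a\<^sup>+\<^sup>b\<^sup>-\<^sup>1 e\<^sup>-\<^sup>u\<close> times the Beta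
  integral, by homogeneity.  Comparing total integrals gives \<open>\<Gamma>(a) \<Gamma>(b) = B(a, b) \<Gamma>(a + b)\<close>.
\<close>
lemma Beta_integral_complex:
  fixes a b :: complex
  assumes a: "Re a > 0" and b: "Re b > 0"
  shows "(LBINT u:{0<..<1}. of_real u powr (a - 1) * of_real (1 - u) powr (b - 1)) = Beta a b"
    (is "?B = _")
proof -
  define f where "f = (\<lambda>z t. indicator {0<..} t *\<^sub>R (of_real t powr (z - 1) / of_real (exp t)) :: complex)"
  have ab: "Re (a + b) > 0" using a b by simp
  have inner: "(LBINT t. f a t * f b (u - t)) = ?B * f (a + b) u" for u
  proof (cases "u > 0")
    case True
    have "f a t * f b (u - t) = of_real (exp (- u)) *
       (indicator {0<..<u} t *\<^sub>R (of_real t powr (a - 1) * of_real (u - t) powr (b - 1)))" for t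
      by (auto simp: f_def indicator_def exp_diff exp_minus field_simps simp del: of_real_diff)
    hence "(LBINT t. f a t * f b (u - t)) = of_real (exp (- u)) *
       (LBINT t:{0<..<u}. of_real t powr (a - 1) * of_real (u - t) powr (b - 1))"
      by (simp only: set_lebesgue_integral_def integral_mult_right_zero)
    also have "\<dots> = ?B * f (a + b) u"
      using True by (subst Beta_interval(2)[OF a b True]) (simp add: f_def exp_minus field_simps)
    finally show ?thesis .
  next
    case False
    hence "f a t * f b (u - t) = 0" for t by (auto simp: f_def indicator_def)
    hence "(LBINT t. f a t * f b (u - t)) = 0" by (simp only: integral_zero)
    moreover have "f (a + b) u = 0" using False by (simp add: f_def)
    ultimately show ?thesis by simp
  qed
  have "Gamma a * Gamma b = (LBINT u. LBINT t. f a t * f b (u - t))"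
    using lborel_convolution[of "f a" "f b"] Gamma_lebesgue_integral[OF a] Gamma_lebesgue_integral[OF b]
    unfolding f_def by simp
  also have "\<dots> = ?B * Gamma (a + b)"
    unfolding inner integral_mult_right_zero using Gamma_lebesgue_integral(2)[OF ab] by (simp only: f_def)
  finally have "Gamma a * Gamma b = ?B * Gamma (a + b)" .
  moreover have "Gamma (a + b) \<noteq> 0"
  proof -
    have "a + b \<notin> \<int>\<^sub>\<le>\<^sub>0" using ab by (auto elim!: nonpos_Ints_cases simp: complex_eq_iff)
    thus ?thesis by (simp add: Gamma_eq_zero_iff)
  qed
  ultimately show ?thesis by (simp add: Beta_def field_simps)
qed

section \<open>The fractional integral of the I-function\<close>

text \<open>The Pochhammer symbols of \<open>a\<close> cancel, which leaves the binomial series of \<open>(1 - z)\<^sup>b\<close>.\<close>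
lemma hyp2F1_cancel:
  assumes "a \<notin> \<int>\<^sub>\<le>\<^sub>0" "norm z < 1"
  shows "hyp2F1 a (- b) a z = (1 - z) powr b"
proof -
  have coeff: "fps_nth (fps_hypergeo [a, - b] [a] 1) n * z ^ n = (b gchoose n) * (- z) ^ n" for n
  proof -
    have "pochhammer a n \<noteq> 0" using assms(1) by (auto simp: pochhammer_eq_0_iff)
    thus ?thesis by (simp add: gbinomial_pochhammer power_minus[of z])
  qed
  have "(\<lambda>n. (b gchoose n) * (- z) ^ n) sums (1 + (- z)) powr b"
    using assms(2) by (intro gen_binomial_complex) simp
  thus ?thesis unfolding hyp2F1_def eval_fps_def coeff by (simp add: sums_iff)
qed

lemma gamma_pow_one:
  assumes "gamma_branch L" "Re s = 0" "Re c > 0"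
  shows "gamma_pow L (c, C, 1) s = Gamma (c + of_real C * s)"
proof -
  have "c + of_real C * s \<notin> \<int>\<^sub>\<le>\<^sub>0" using assms by (intro Re_pos_not_nonpos_Ints) simp
  moreover from this have "exp (L (c, C, 1) s) = Gamma (c + of_real C * s)"
    using assms(1,2) unfolding gamma_branch_def by (metis (mono_tags, lifting) case_prod_conv mem_Collect_eq)
  ultimately show ?thesis by (simp add: gamma_pow_def)
qed

text \<open>
  A new upper triple at the head of the list joins the numerator, and a new lower triple at the end
  joins the denominator.  With exponent 1 no choice of branch enters.
\<close>
lemma I_chi_adjoin_quotient:
  assumes "gamma_branch L" "m \<le> length ls" "Re s = 0" "Re c > 0" "Re d > 0"
  shows "I_chi L m (n + 1) ((1 - c, \<mu>, 1) # us) (ls @ [(1 - d, \<mu>, 1)]) s =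
           I_chi L m n us ls s * (Gamma (c - of_real \<mu> * s) / Gamma (d - of_real \<mu> * s))"
  using assms by (simp add: I_chi_def gamma_pow_one mult_ac)

text \<open>
  The dependence on \<open>t\<close> is isolated in the factor \<open>t\<^sup>-\<^sup>\<mu>\<^sup>s\<close>.  As \<open>t\<^sup>\<mu> > 0\<close>, the argument \<open>\<theta>\<close> belongs
  to \<open>a\<close> and to \<open>a t\<^sup>\<mu>\<close> alike.
\<close>
lemma I_fun_power_argument:
  assumes "a \<noteq> 0" "t > 0"
  shows "I_fun L m n us ls \<theta> (a * of_real (t powr \<mu>)) =
    1 / of_real (2 * pi) *
      (LBINT \<tau>. I_chi L m n us ls (\<i> * of_real \<tau>) *
         exp (- (\<i> * of_real \<tau>) * (of_real (ln (cmod a)) + \<i> * of_real \<theta>)) *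
         of_real t powr (- (of_real \<mu> * (\<i> * of_real \<tau>))))"
proof -
  have "ln (cmod (a * of_real (t powr \<mu>))) = ln (cmod a) + \<mu> * ln t"
    using assms by (simp add: norm_mult ln_mult ln_powr)
  hence eq: "I_chi L m n us ls (\<i> * of_real \<tau>) *
      exp (- (\<i> * of_real \<tau>) * (of_real (ln (cmod (a * of_real (t powr \<mu>)))) + \<i> * of_real \<theta>)) * \<i> =
      (I_chi L m n us ls (\<i> * of_real \<tau>) *
         exp (- (\<i> * of_real \<tau>) * (of_real (ln (cmod a)) + \<i> * of_real \<theta>)) *
         of_real t powr (- (of_real \<mu> * (\<i> * of_real \<tau>)))) * \<i>" for \<tau>
    using assms by (simp add: powr_def Ln_of_real algebra_simps flip: exp_add)
  show ?thesis unfolding I_fun_def eq integral_mult_left_zero by simp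
qed

text \<open>The exponential factor has modulus \<open>exp (\<theta> \<tau>)\<close>, whatever the modulus of \<open>z\<close>.\<close>
lemma integrable_I_integrand:
  assumes "gamma_branch L" "I_admissible m n us ls \<theta>"
  shows "integrable lborel (\<lambda>\<tau>. I_chi L m n us ls (\<i> * of_real \<tau>) *
           exp (- (\<i> * of_real \<tau>) * (of_real r + \<i> * of_real \<theta>)))"
proof -
  have adm: "I_params m n us ls" "I_separated m n us ls" "I_abs_conv m n us ls \<theta>"
    using assms(2) by (auto simp: I_admissible_def)
  note growth = vertical_growth_I_chi[OF assms(1) adm(1,2)]
  have int: "integrable lborel (\<lambda>\<tau>. norm (I_chi L m n us ls (\<i> * of_real \<tau>)) * exp (\<bar>\<theta>\<bar> * \<bar>\<tau>\<bar>))"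
    using adm(3) by (intro integrable_vertical_growth[OF growth]) (auto simp: I_abs_conv_def Let_def)
  have [measurable]: "(\<lambda>\<tau>. I_chi L m n us ls (\<i> * of_real \<tau>)) \<in> borel_measurable borel"
    using growth by (simp add: vertical_growth_def)
  show ?thesis
  proof (rule Bochner_Integration.integrable_bound[OF int _ AE_I2])
    fix \<tau>
    have "\<theta> * \<tau> \<le> \<bar>\<theta>\<bar> * \<bar>\<tau>\<bar>" by (metis abs_ge_self abs_mult)
    thus "norm (I_chi L m n us ls (\<i> * of_real \<tau>) * exp (- (\<i> * of_real \<tau>) * (of_real r + \<i> * of_real \<theta>)))
        \<le> norm (norm (I_chi L m n us ls (\<i> * of_real \<tau>)) * exp (\<bar>\<theta>\<bar> * \<bar>\<tau>\<bar>))"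
      by (simp add: norm_mult mult.commute[of \<tau>] mult_left_mono)
  qed measurable
qed

lemma integrable_product:
  fixes f g :: "real \<Rightarrow> complex"
  assumes f: "integrable lborel f" and g: "integrable lborel g"
  shows "integrable (lborel \<Otimes>\<^sub>M lborel) (\<lambda>(s, t). f s * g t)"
proof (rule lborel_pair.Fubini_integrable)
  note [measurable] = borel_measurable_integrable[OF f] borel_measurable_integrable[OF g]
  show "(\<lambda>(s, t). f s * g t) \<in> borel_measurable (lborel \<Otimes>\<^sub>M lborel)" by measurable
  show "integrable lborel (\<lambda>s. LBINT t. norm (case (s, t) of (s, t) \<Rightarrow> f s * g t))"
    using f by (simp add: norm_mult)
  show "AE s in lborel. integrable lborel (\<lambda>t. case (s, t) of (s, t) \<Rightarrow> f s * g t)"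
    using g by simp
qed

text \<open>
  The exchange of integrals, for an arbitrary integrable \<open>h\<close> in place of the integrand of an
  I-function.  Since \<open>\<bar>t\<^sup>-\<^sup>\<i>\<^sup>\<mu>\<^sup>\<tau>\<bar> = 1\<close>, the double integral is dominated by the product of the
  integrals of \<open>\<bar>h\<bar>\<close> and of a Beta kernel; the inner integral over \<open>t\<close> is a Beta integral whose
  first parameter is moved along a vertical line, \<open>c - \<i> \<mu> \<tau>\<close>.
\<close>
lemma Beta_kernel_Fubini:
  fixes h :: "real \<Rightarrow> complex" and c \<alpha> :: complex and \<mu> x :: real
  assumes h: "integrable lborel h" and c: "Re c > 0" and \<alpha>: "Re \<alpha> > 0" and x: "x > 0"
  defines "k \<equiv> (\<lambda>t. of_real t powr (c - 1) * of_real (x - t) powr (\<alpha> - 1) *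
                 (LBINT \<tau>. h \<tau> * of_real t powr (- (of_real \<mu> * (\<i> * of_real \<tau>)))))"
  shows "set_integrable lborel {0<..<x} k"
    and "(LBINT t:{0<..<x}. k t) =
      of_real x powr (c + \<alpha> - 1) *
      (LBINT \<tau>. h \<tau> * of_real x powr (- (of_real \<mu> * (\<i> * of_real \<tau>))) *
         Beta (c - of_real \<mu> * (\<i> * of_real \<tau>)) \<alpha>)"
proof -
  \<comment> \<open>\<open>e\<close> replaces the complex power by an exponential in \<open>ln t\<close>: both agree for \<open>t > 0\<close>, but the
    exponential is measurable in \<open>(\<tau>, t)\<close> jointly and of modulus 1 for all \<open>t\<close>.\<close>
  define w where "w = (\<lambda>t. indicator {0<..<x} t *\<^sub>R (of_real t powr (c - 1) * of_real (x - t) powr (\<alpha> - 1)))"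
  define e where "e = (\<lambda>\<tau> t. exp (- (of_real \<mu> * (\<i> * of_real \<tau>)) * of_real (ln t)))"
  have e: "of_real t powr (- (of_real \<mu> * (\<i> * of_real \<tau>))) = e \<tau> t" if "t > 0" for \<tau> t
    using that by (simp add: e_def powr_def Ln_of_real)
  have norm_e: "norm (e \<tau> t) = 1" for \<tau> t by (simp add: e_def)
  have w: "integrable lborel w"
    using Beta_interval(1)[OF c \<alpha> x] by (simp add: set_integrable_def w_def)
  have prod: "integrable (lborel \<Otimes>\<^sub>M lborel) (\<lambda>(\<tau>, t). h \<tau> * w t)"
    by (rule integrable_product[OF h w])
  note [measurable] = borel_measurable_integrable[OF h] borel_measurable_integrable[OF w]
  have double: "integrable (lborel \<Otimes>\<^sub>M lborel) (\<lambda>(\<tau>, t). h \<tau> * w t * e \<tau> t)"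
  proof (rule Bochner_Integration.integrable_bound[OF prod])
    show "(\<lambda>(\<tau>, t). h \<tau> * w t * e \<tau> t) \<in> borel_measurable (lborel \<Otimes>\<^sub>M lborel)"
      unfolding e_def by measurable
  qed (auto simp: norm_mult norm_e)
  have over_tau: "(LBINT \<tau>. h \<tau> * w t * e \<tau> t) = indicator {0<..<x} t *\<^sub>R k t" for t
  proof (cases "t \<in> {0<..<x}")
    case True
    have "(LBINT \<tau>. h \<tau> * w t * e \<tau> t) = (LBINT \<tau>. w t * (h \<tau> * e \<tau> t))" by (simp add: mult_ac)
    also have "\<dots> = w t * (LBINT \<tau>. h \<tau> * e \<tau> t)" by (rule integral_mult_right_zero)
    finally show ?thesis using True by (simp add: w_def k_def e)
  qed (simp add: w_def)
  show "set_integrable lborel {0<..<x} k"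
    using lborel_pair.integrable_snd[OF double] unfolding over_tau set_integrable_def .
  have over_t: "(LBINT t. h \<tau> * w t * e \<tau> t) = of_real x powr (c + \<alpha> - 1) *
      (h \<tau> * of_real x powr (- (of_real \<mu> * (\<i> * of_real \<tau>))) * Beta (c - of_real \<mu> * (\<i> * of_real \<tau>)) \<alpha>)" for \<tau>
  proof -
    define d where "d = c - of_real \<mu> * (\<i> * of_real \<tau>)"
    have d: "Re d > 0" using c by (simp add: d_def)
    have "h \<tau> * w t * e \<tau> t = h \<tau> * (indicator {0<..<x} t *\<^sub>R
        (of_real t powr (d - 1) * of_real (x - t) powr (\<alpha> - 1)))" for t
    proof (cases "t \<in> {0<..<x}")
      case True
      have "of_real t powr (d - 1) = of_real t powr (c - 1) * of_real t powr (- (of_real \<mu> * (\<i> * of_real \<tau>)))"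
        by (simp add: d_def algebra_simps flip: powr_add)
      thus ?thesis using True by (simp add: w_def e)
    qed (simp add: w_def)
    hence "(LBINT t. h \<tau> * w t * e \<tau> t) =
        h \<tau> * (LBINT t:{0<..<x}. of_real t powr (d - 1) * of_real (x - t) powr (\<alpha> - 1))"
      by (simp only: set_lebesgue_integral_def integral_mult_right_zero)
    also have "\<dots> = h \<tau> * (of_real x powr (d + \<alpha> - 1) * Beta d \<alpha>)"
      by (simp only: Beta_interval(2)[OF d \<alpha> x] Beta_integral_complex[OF d \<alpha>])
    also have "of_real x powr (d + \<alpha> - 1) =
        of_real x powr (c + \<alpha> - 1) * of_real x powr (- (of_real \<mu> * (\<i> * of_real \<tau>)))"
      by (simp add: d_def algebra_simps flip: powr_add)
    finally show ?thesis by (simp add: d_def mult_ac)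
  qed
  have "(LBINT t:{0<..<x}. k t) = (LBINT t. LBINT \<tau>. h \<tau> * w t * e \<tau> t)"
    by (simp only: set_lebesgue_integral_def over_tau)
  also have "\<dots> = (LBINT \<tau>. LBINT t. h \<tau> * w t * e \<tau> t)"
    by (rule lborel_pair.Fubini_integral[OF double])
  finally show "(LBINT t:{0<..<x}. k t) = of_real x powr (c + \<alpha> - 1) *
      (LBINT \<tau>. h \<tau> * of_real x powr (- (of_real \<mu> * (\<i> * of_real \<tau>))) *
         Beta (c - of_real \<mu> * (\<i> * of_real \<tau>)) \<alpha>)"
    by (simp only: over_t integral_mult_right_zero)
qed

theorem corollary3p2:
  fixes \<alpha> \<gamma> \<rho> a :: complex and \<mu> \<theta> x :: real and m n :: nat
    and us ls :: "triple list" and L :: "triple \<Rightarrow> complex \<Rightarrow> complex"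
    and f :: "real \<Rightarrow> complex"
  assumes "a \<noteq> 0"
    and "a = of_real (cmod a) * cis \<theta>"
    and "Re \<alpha> > 0" and "\<mu> > 0" and "Re \<rho> > max 0 (Re (- \<gamma>))"
    and "gamma_branch L"
    and "I_admissible m n us ls \<theta>"
    and "I_admissible m (n + 1) ((1 - \<gamma> - \<rho>, \<mu>, 1) # us) (ls @ [(1 - \<alpha> - \<gamma> - \<rho>, \<mu>, 1)]) \<theta>"
    and "x > 0"
  defines "f \<equiv> (\<lambda>t. of_real t powr (\<rho> - 1) * I_fun L m n us ls \<theta> (a * of_real (t powr \<mu>)))"
  shows "set_integrable lborel {0<..<x} (saigo_integrand \<alpha> 0 \<gamma> f x) \<and>
         erdelyi_kober \<gamma> \<alpha> f x =
           of_real x powr (\<rho> - 1) *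
           I_fun L m (n + 1) ((1 - \<gamma> - \<rho>, \<mu>, 1) # us) (ls @ [(1 - \<alpha> - \<gamma> - \<rho>, \<mu>, 1)]) \<theta>
             (a * of_real (x powr \<mu>))"
proof -
  define h where "h = (\<lambda>\<tau>. I_chi L m n us ls (\<i> * of_real \<tau>) *
         exp (- (\<i> * of_real \<tau>) * (of_real (ln (cmod a)) + \<i> * of_real \<theta>)))"
  define c where "c = \<gamma> + \<rho>"
  define k where "k = (\<lambda>t. of_real t powr (c - 1) * of_real (x - t) powr (\<alpha> - 1) *
                 (LBINT \<tau>. h \<tau> * of_real t powr (- (of_real \<mu> * (\<i> * of_real \<tau>)))))"
  \<comment> \<open>The constant collects the factor \<open>x\<^sup>-\<^sup>\<gamma>\<close> from \<open>(t/x)\<^sup>\<gamma>\<close> and the normalization of the I-function.\<close>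
  define C where "C = of_real x powr (- \<gamma>) / of_real (2 * pi)"
  have c: "Re c > 0" "Re (c + \<alpha>) > 0" using assms by (auto simp: c_def)
  have \<alpha>: "\<alpha> \<notin> \<int>\<^sub>\<le>\<^sub>0" using Re_pos_not_nonpos_Ints[OF \<open>Re \<alpha> > 0\<close>] .
  have h: "integrable lborel h"
    unfolding h_def by (rule integrable_I_integrand) (use assms in auto)
  note Fubini = Beta_kernel_Fubini[OF h c(1) \<open>Re \<alpha> > 0\<close> \<open>x > 0\<close>, of \<mu>, folded k_def]
  have saigo: "saigo_integrand \<alpha> 0 \<gamma> f x t = C * k t" if t: "t \<in> {0<..<x}" for t
  proof -
    have "hyp2F1 \<alpha> (- \<gamma>) \<alpha> (of_real (1 - t / x)) = of_real (t / x) powr \<gamma>"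
    proof -
      have "norm (complex_of_real (1 - t / x)) < 1"
        unfolding norm_of_real using t by (simp add: abs_less_iff field_simps)
      from hyp2F1_cancel[OF \<alpha> this] show ?thesis by simp
    qed
    also have "\<dots> = of_real x powr (- \<gamma>) * of_real t powr \<gamma>"
    proof -
      have "of_real t powr \<gamma> = of_real (x * (t / x)) powr \<gamma>" using t by simp
      also have "\<dots> = of_real x powr \<gamma> * of_real (t / x) powr \<gamma>"
        using t by (intro powr_of_real_mult) auto
      finally show ?thesis using t by (simp add: powr_minus field_simps)
    qed
    moreover have "of_real t powr \<gamma> * of_real t powr (\<rho> - 1) = of_real t powr (c - 1)"
      by (simp add: c_def algebra_simps flip: powr_add)
    moreover have "f t = of_real t powr (\<rho> - 1) * (1 / of_real (2 * pi) *
        (LBINT \<tau>. h \<tau> * of_real t powr (- (of_real \<mu> * (\<i> * of_real \<tau>)))))"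
      using t unfolding f_def h_def by (subst I_fun_power_argument[OF \<open>a \<noteq> 0\<close>]) auto
    ultimately show ?thesis
      by (simp add: saigo_integrand_def k_def C_def mult_ac del: of_real_diff of_real_divide)
  qed
  have "set_integrable lborel {0<..<x} (\<lambda>t. C * k t)"
    using Fubini(1) by simp
  hence int: "set_integrable lborel {0<..<x} (saigo_integrand \<alpha> 0 \<gamma> f x)"
    by (subst set_integrable_cong[OF refl refl saigo]) auto
  have chi: "I_chi L m (n + 1) ((1 - \<gamma> - \<rho>, \<mu>, 1) # us) (ls @ [(1 - \<alpha> - \<gamma> - \<rho>, \<mu>, 1)]) (\<i> * of_real \<tau>)
      = I_chi L m n us ls (\<i> * of_real \<tau>) * (Beta (c - of_real \<mu> * (\<i> * of_real \<tau>)) \<alpha> / Gamma \<alpha>)" for \<tau>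
  proof -
    have "m \<le> length ls" using assms(7) by (simp add: I_admissible_def I_params_def)
    moreover have "1 - \<gamma> - \<rho> = 1 - c" "1 - \<alpha> - \<gamma> - \<rho> = 1 - (c + \<alpha>)" by (simp_all add: c_def)
    moreover have "Gamma \<alpha> \<noteq> 0" using \<alpha> by (simp add: Gamma_eq_zero_iff)
    ultimately show ?thesis
      using I_chi_adjoin_quotient[OF assms(6), of m ls "\<i> * of_real \<tau>" c "c + \<alpha>" n \<mu> us] c
      by (simp add: Beta_def algebra_simps)
  qed
  have "erdelyi_kober \<gamma> \<alpha> f x = of_real x powr (- \<alpha>) / Gamma \<alpha> * (LBINT t:{0<..<x}. C * k t)"
    unfolding erdelyi_kober_def saigo_integral_def
    by (subst set_lebesgue_integral_cong[of _ _ _ "\<lambda>t. C * k t"]) (auto simp: saigo)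
  also have "(LBINT t:{0<..<x}. C * k t) = C * (LBINT t:{0<..<x}. k t)" by simp
  also have "of_real x powr (- \<alpha>) / Gamma \<alpha> * \<dots> =
      of_real x powr (- \<alpha>) * of_real x powr (- \<gamma>) * of_real x powr (c + \<alpha> - 1) *
      (1 / of_real (2 * pi) * (1 / Gamma \<alpha> *
        (LBINT \<tau>. h \<tau> * of_real x powr (- (of_real \<mu> * (\<i> * of_real \<tau>))) *
           Beta (c - of_real \<mu> * (\<i> * of_real \<tau>)) \<alpha>)))"
    unfolding Fubini(2) C_def by (simp add: field_simps)
  also have "of_real x powr (- \<alpha>) * of_real x powr (- \<gamma>) * of_real x powr (c + \<alpha> - 1) =
      (of_real x powr (\<rho> - 1) :: complex)"
    by (simp add: c_def algebra_simps flip: powr_add)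
  also have "1 / of_real (2 * pi) * (1 / Gamma \<alpha> *
        (LBINT \<tau>. h \<tau> * of_real x powr (- (of_real \<mu> * (\<i> * of_real \<tau>))) *
           Beta (c - of_real \<mu> * (\<i> * of_real \<tau>)) \<alpha>)) =
      I_fun L m (n + 1) ((1 - \<gamma> - \<rho>, \<mu>, 1) # us) (ls @ [(1 - \<alpha> - \<gamma> - \<rho>, \<mu>, 1)]) \<theta>
             (a * of_real (x powr \<mu>))"
    unfolding I_fun_power_argument[OF \<open>a \<noteq> 0\<close> \<open>x > 0\<close>] chi h_def
    by (subst integral_mult_right_zero [symmetric]) (simp add: mult_ac)
  finally show ?thesis using int by simp
qed

end
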